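(* Let $b,c\in\mathbb{R}$ and let $\{H_m(z)\}_{m\ge0}$ be the sequence of polynomials in $z$ defined by $H_0(z)=1$, $H_1(z)=-c$, $H_2(z)=-b+c^2$ and \[ H_m(z)+cH_{m-1}(z)+bH_{m-2}(z)+zH_{m-3}(z)=0,\qquad m\ge3. \] Then the zeros of $H_m(z)$ are real for all $m$ if and only if one of the following holds: (i) $c=0$ and $b\ge0$; (ii) $c\neq0$ and $-1\le b/c^2\le 1/3$. Moreover, in case (i) with $b>0$, the set $\bigcup_{m=0}^{\infty}\mathcal{Z}(H_m)$ is dense in $(-\infty,\infty)$. In case (ii), $\bigcup_{m=0}^{\infty}\mathcal{Z}(H_m)$ is dense in the set \[ \left\{c^3x:\ x\in\left(-\infty,\ \frac{-2+9b/c^2-2\sqrt{(1-3b/c^2)^3}}{27}\right]\right\}. \]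
   Context: $\mathcal{Z}(H_m)$ denotes the set of zeros of the polynomial $H_m(z)$. Convention: the zeros of the constant zero polynomial are considered real. *)

theory Defs
  imports "HOL-Analysis.Analysis" "HOL-Computational_Algebra.Polynomial"
begin

text \<open>The polynomials H_m(z) with real parameters b, c, viewed as complex polynomials
  (so that their zeros can be non-real).\<close>
fun H :: "real \<Rightarrow> real \<Rightarrow> nat \<Rightarrow> complex poly" where
  "H b c 0 = 1"
| "H b c (Suc 0) = [: - complex_of_real c :]"
| "H b c (Suc (Suc 0)) = [: - complex_of_real b + (complex_of_real c)^2 :]"
| "H b c (Suc (Suc (Suc m))) =
     - (smult (complex_of_real c) (H b c (Suc (Suc m)))
        + smult (complex_of_real b) (H b c (Suc m))
        + [:0, 1:] * H b c m)"

definition zeros_real :: "complex poly \<Rightarrow> bool" where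
  "zeros_real p \<longleftrightarrow> p = 0 \<or> (\<forall>z. poly p z = 0 \<longrightarrow> Im z = 0)"

definition zero_union :: "real \<Rightarrow> real \<Rightarrow> real set" where
  "zero_union b c = {x. \<exists>m. H b c m \<noteq> 0 \<and> poly (H b c m) (complex_of_real x) = 0}"

end

theory Submission
  imports Defs "HOL-Complex_Analysis.Conformal_Mappings"
    "HOL-Computational_Algebra.Fundamental_Theorem_Algebra"
begin

text \<open>
  If p, q, s are the roots of x^3 + c x^2 + b x + z, then H_m(z) is the complete homogeneous
  symmetric polynomial h_m(p, q, s), so H_m(z) times the Vandermonde determinant of the roots is a
  combination of (m+2)-nd powers.

  Sufficiency and density: after scaling, c = 1 or c = 0. A real z whose cubic has exactly one real
  root r and a dominant non-real pair X, cnj X is parametrised by r. Then H_m(z) has the sign of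
  r^(m+2) Im X + |X|^(m+2) |X - r| sin (phase), where the sine dominates whenever it is 1 or -1.
  The total variation of the phase forces as many real zeros as the degree of H_m allows, and on
  every interval of r it tends to infinity with m, which gives density.

  Necessity: for a real-rooted polynomial p, |p(w2)|^2 is at least |p(w1)| |p(w3)| whenever
  |w2 - t|^2 is at least |w1 - t| |w3 - t| for all real t. As m grows this transfers to the maximal modulus of
  the roots of the cubic. It fails near the point z = a (if a = b/c^2 < -1) or z = a^3 (if a > 1/3),
  where roots of equal modulus exchange dominance along a curve leaving the real axis.
\<close>

subsection \<open>The recurrence\<close>

text \<open>The obstacle is that all zeros have to be caught, so the pair must dominate on a whole
  range of r on which the phase varies enough. For c = 1, b = a this range is r > l, where l is the
  third root at the moment when the pair merges into a double root; the asserted interval ends at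
  the value of z for r = l. Dominance on all of r > l is what asks for -1 \<le> a \<le> 1/3. Near l
  the phase exceeds (m + 1/2) pi, at infinity it tends to (4 m + 3) pi / 6. The odd multiples of
  pi/2 passed in between give m div 3 sign changes, which is the degree bound. For c = 0, b > 0
  every r is admissible and the symmetry r -> -r replaces the left end. Monotonicity of the phase is
  never proved: only its values at the ends enter, through the intermediate value theorem. For
  density, injectivity of arg X in r is enough. In the necessity part the three test points are z0 +
  e W with fixed directions W and small e > 0, so that comparing growth rates reduces to comparing
  first derivatives of the logarithms of the moduli of the roots.\<close>

lemma nat_cases_3:
  obtains "m = 0" | "m = 1" | "m = 2" | k where "m = Suc (Suc (Suc k))"
  by (metis One_nat_def Suc_1 not0_implies_Suc)

text \<open>Each root x makes x^(m+2) a solution of the recurrence, hence both sides solve it; m =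
  0, 1, 2 are checked by expansion. The Vandermonde product stays on the left to avoid
  division.\<close>

lemma H_vandermonde:
  fixes p q s z :: complex
  assumes "p + q + s = - complex_of_real c" "p * q + q * s + p * s = complex_of_real b" "p * q * s = - z"
  shows "poly (H b c m) z * ((p - q) * (q - s) * (p - s))
       = p ^ (m + 2) * (q - s) - q ^ (m + 2) * (p - s) + s ^ (m + 2) * (p - q)"
proof -
  have C: "complex_of_real c = - (p + q + s)" and B: "complex_of_real b = p * q + q * s + p * s"
    and Z: "z = - (p * q * s)"
    using assms by auto
  show ?thesis
  proof (induction m rule: less_induct)
    case (less m)
    let ?V = "(p - q) * (q - s) * (p - s)"
    show ?case
    proof (cases m rule: nat_cases_3)
      case (4 k)
      have "poly (H b c m) z * ?V = - (complex_of_real c * (poly (H b c (k + 2)) z * ?V)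
          + complex_of_real b * (poly (H b c (k + 1)) z * ?V) + z * (poly (H b c k) z * ?V))"
        unfolding 4 by (simp add: algebra_simps)
      also have "\<dots> = - (complex_of_real c * (p ^ (k + 4) * (q - s) - q ^ (k + 4) * (p - s) + s ^ (k + 4) * (p - q))
          + complex_of_real b * (p ^ (k + 3) * (q - s) - q ^ (k + 3) * (p - s) + s ^ (k + 3) * (p - q))
          + z * (p ^ (k + 2) * (q - s) - q ^ (k + 2) * (p - s) + s ^ (k + 2) * (p - q)))"
        using less[of k] less[of "k+1"] less[of "k+2"] 4 by (simp add: eval_nat_numeral)
      also have "\<dots> = p ^ (k + 5) * (q - s) - q ^ (k + 5) * (p - s) + s ^ (k + 5) * (p - q)"
        unfolding C B Z power_add by algebra
      finally show ?thesis using 4 by (simp add: eval_nat_numeral)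
    next
      case 1 then show ?thesis by (simp add: algebra_simps power2_eq_square)
    next
      case 2
      then have "poly (H b c m) z = p + q + s" using C by simp
      moreover have "(p + q + s) * ((p - q) * (q - s) * (p - s)) = p ^ 3 * (q - s) - q ^ 3 * (p - s) + s ^ 3 * (p - q)"
        by (simp add: algebra_simps power3_eq_cube)
      ultimately show ?thesis using 2 by (simp add: eval_nat_numeral)
    next
      case 3
      have "poly (H b c m) z = - (p * q + q * s + p * s) + (- (p + q + s))^2"
        using 3 by (simp add: B C numeral_2_eq_2 power2_eq_square)
      then have "poly (H b c m) z = - (p * q + q * s + p * s) + (p + q + s)^2"
        by (simp only: power2_minus)
      moreover have "(- (p * q + q * s + p * s) + (p + q + s)^2) * ((p - q) * (q - s) * (p - s))
          = p ^ 4 * (q - s) - q ^ 4 * (p - s) + s ^ 4 * (p - q)"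
        by (simp add: algebra_simps power2_eq_square power4_eq_xxxx)
      ultimately show ?thesis using 3 by simp
    qed
  qed
qed

text \<open>Give c, b, z the weights 1, 2, 3: then H_m is homogeneous of weight m.\<close>

lemma H_scale:
  assumes "c \<noteq> 0"
  shows "poly (H b c m) z = complex_of_real c ^ m * poly (H (b / c^2) 1 m) (z / complex_of_real c ^ 3)"
proof (induction m rule: less_induct)
  case (less m)
  show ?case
  proof (cases m rule: nat_cases_3)
    case (4 k)
    then show ?thesis using less[of k] less[of "Suc k"] less[of "Suc (Suc k)"] assms
      by (simp add: field_simps power2_eq_square power3_eq_cube)
  qed (use assms in \<open>simp_all add: numeral_2_eq_2 power2_eq_square field_simps\<close>)
qed

lemma degree_H: "degree (H b c m) \<le> m div 3"
proof (induction m rule: less_induct)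
  case (less m)
  show ?case
  proof (cases m rule: nat_cases_3)
    case (4 k)
    have d: "m div 3 = Suc (k div 3)" unfolding 4 by presburger
    have "degree (smult (complex_of_real c) (H b c (Suc (Suc k)))) \<le> m div 3"
      using less[of "Suc (Suc k)"] 4 div_le_mono[of "Suc (Suc k)" m 3]
      by (meson degree_smult_le le_trans le_SucI lessI less_imp_le)
    moreover have "degree (smult (complex_of_real b) (H b c (Suc k))) \<le> m div 3"
      using less[of "Suc k"] 4 div_le_mono[of "Suc k" m 3] 
      by (meson degree_smult_le le_trans le_SucI lessI less_imp_le less_SucI)
    moreover have "degree ([:0, 1:] * H b c k) \<le> m div 3"
      using less[of k] 4 d by (auto intro: order.trans[OF degree_mult_le])
    ultimately show ?thesis unfolding 4 H.simps by (simp only: degree_minus) (intro degree_add_le)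
  qed (simp_all add: numeral_2_eq_2)
qed

text \<open>For c = 0 the monomials of H_m are b^i z^j with 2 i + 3 j = m. With m = 3 n + 1, the
  power j = n would need 2 i = 1. This lost degree matches the smaller count of sign changes in
  \<open>zeros_real_c0\<close>.\<close>

lemma degree_H_c0: "degree (H b 0 (3 * n + 1)) \<le> n - 1"
proof (induction n rule: less_induct)
  case (less n)
  show ?case
  proof (cases n rule: nat_cases_3)
    case 3
    then show ?thesis by (simp add: numeral_eq_Suc)
  next
    case (4 k)
    have e: "3 * n + 1 = Suc (Suc (Suc (3 * Suc (Suc k) + 1)))" using 4 by simp
    have f: "Suc (3 * Suc (Suc k) + 1) div 3 = Suc (Suc k)" by presburger
    have "degree (smult (complex_of_real b) (H b 0 (Suc (3 * Suc (Suc k) + 1)))) \<le> n - 1"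
      using degree_H[of b 0 "Suc (3 * Suc (Suc k) + 1)"] 4 unfolding f
      by (auto intro: order.trans[OF degree_smult_le])
    moreover have "degree ([:0, 1:] * H b 0 (3 * Suc (Suc k) + 1)) \<le> n - 1"
      using less[of "Suc (Suc k)"] 4 by (auto intro: order.trans[OF degree_mult_le])
    ultimately show ?thesis unfolding e H.simps
      by (simp only: degree_minus of_real_0 smult_0_left add_0) (intro degree_add_le)
  qed (simp_all add: numeral_eq_Suc)
qed

lemma H_b0: "H 0 0 m = (if 3 dvd m then [:0, -1:] ^ (m div 3) else 0)"
proof (induction m rule: less_induct)
  case (less m)
  show ?case
  proof (cases m rule: nat_cases_3)
    case (4 k)
    have d: "m div 3 = Suc (k div 3)" "3 dvd m \<longleftrightarrow> 3 dvd k" unfolding 4 by presburger+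
    show ?thesis using less[of k] 4 d by simp
  next
    case 3
    then have "\<not> 3 dvd m" by simp
    then show ?thesis using 3 by (simp add: numeral_2_eq_2)
  qed simp_all
qed

subsection \<open>Parametrisation by the real root\<close>

text \<open>The argument with its cut along the negative imaginary axis. \<open>Arg\<close> jumps at
  the negative reals, which is where the pair merges at the left end of the range of r;
  \<open>upper_arg\<close> is continuous there, with value pi.\<close>

definition upper_arg :: "complex \<Rightarrow> real" where
  "upper_arg w = pi / 2 + Arg (- \<i> * w)"

lemma upper_arg_polar: "of_real (cmod w) * cis (upper_arg w) = w"
proof -
  have "of_real (cmod w) * cis (upper_arg w) = \<i> * rcis (cmod (-\<i> * w)) (Arg (-\<i> * w))"
    unfolding upper_arg_def cis_mult[symmetric] rcis_def
    by (simp add: norm_mult)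
  also have "\<dots> = w" unfolding rcis_cmod_Arg by simp
  finally show ?thesis .
qed

lemma upper_arg_bounds:
  assumes "Im w > 0"
  shows "0 < upper_arg w" "upper_arg w < pi"
proof -
  have "w \<noteq> 0" using assms by auto
  then have "Arg (- \<i> * w) = Im (Ln (- \<i> * w))" by (intro Arg_eq_Im_Ln) auto
  moreover have "\<bar>Im (Ln (- \<i> * w))\<bar> < pi / 2" 
    using Re_Ln_pos_lt[of "- \<i> * w"] assms \<open>w \<noteq> 0\<close> by auto
  ultimately show "0 < upper_arg w" "upper_arg w < pi" unfolding upper_arg_def by linarith+
qed

lemma upper_arg_scale: "r > 0 \<Longrightarrow> upper_arg (of_real r * w) = upper_arg w"
proof -
  assume "r > 0"
  then have "Arg (of_real r * (- \<i> * w)) = Arg (- \<i> * w)" by (rule Arg_times_of_real)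
  then show ?thesis unfolding upper_arg_def by (simp add: algebra_simps)
qed

lemma upper_arg_cis: "0 \<le> t \<Longrightarrow> t \<le> pi \<Longrightarrow> upper_arg (cis t) = t"
proof -
  assume t: "0 \<le> t" "t \<le> pi"
  have "cis t = \<i> * cis (t - pi / 2)" 
    by (simp add: complex_eq_iff cos_diff sin_diff)
  then have "- \<i> * cis t = cis (t - pi / 2)" by simp
  moreover have "Arg (cis (t - pi / 2)) = t - pi / 2" using t pi_gt_zero
    by (intro Arg_cis) (auto simp del: pi_gt_zero)
  ultimately show ?thesis unfolding upper_arg_def by simp
qed

lemma isCont_upper_arg:
  assumes "Im w > 0 \<or> Re w \<noteq> 0"
  shows "isCont upper_arg w"
proof -
  have "- \<i> * w \<notin> \<real>\<^sub>\<le>\<^sub>0" using assms by (auto simp: complex_nonpos_Reals_iff)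
  then have "isCont Arg (- \<i> * w)" by (rule continuous_at_Arg)
  then have "isCont (\<lambda>w. Arg (- \<i> * w)) w" by (intro isCont_o2[of w "\<lambda>w. - \<i> * w" Arg]) auto
  then show ?thesis unfolding upper_arg_def[abs_def] by (intro continuous_intros)
qed

text \<open>Dividing the cubic by x - r leaves x^2 + (c + r) x + (r^2 + c r + b). This is minus its
  discriminant, positive exactly when the other two roots are non-real.\<close>

definition disc :: "real \<Rightarrow> real \<Rightarrow> real \<Rightarrow> real" where
  "disc b c r = 3 * r^2 + 2 * c * r + 4 * b - c^2"

definition nonreal_root :: "real \<Rightarrow> real \<Rightarrow> real \<Rightarrow> complex" where
  "nonreal_root b c r = Complex (- (c + r) / 2) (sqrt (disc b c r) / 2)"

definition root_param :: "real \<Rightarrow> real \<Rightarrow> real \<Rightarrow> real" where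
  "root_param b c r = - (r^3 + c * r^2 + b * r)"

definition phase :: "real \<Rightarrow> real \<Rightarrow> nat \<Rightarrow> real \<Rightarrow> real" where
  "phase b c m r = (real m + 2) * upper_arg (nonreal_root b c r)
     - upper_arg (nonreal_root b c r - complex_of_real r)"

definition osc :: "real \<Rightarrow> real \<Rightarrow> nat \<Rightarrow> real \<Rightarrow> real" where
  "osc b c m r = r ^ (m + 2) * Im (nonreal_root b c r)
     + cmod (nonreal_root b c r) ^ (m + 2) * cmod (nonreal_root b c r - complex_of_real r) * sin (phase b c m r)"

text \<open>The pair has the product |X|^2 = r^2 + (b + c r), so the second condition says |X| >
  |r|.\<close>

definition pair_dominant :: "real \<Rightarrow> real \<Rightarrow> real set" where
  "pair_dominant b c = {r. disc b c r > 0 \<and> b + c * r > 0}"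

lemma Im_nonreal_root: "disc b c r > 0 \<Longrightarrow> Im (nonreal_root b c r) > 0"
  by (simp add: nonreal_root_def)

lemma cmod_nonreal_root: "disc b c r \<ge> 0 \<Longrightarrow> (cmod (nonreal_root b c r))^2 = r^2 + (b + c * r)"
  by (simp add: nonreal_root_def cmod_power2 power_divide)
     (simp add: disc_def field_simps power2_eq_square)

lemma osc_eq_Im:
  "Im (nonreal_root b c r ^ (m + 2) * (cnj (nonreal_root b c r) - of_real r))
   = cmod (nonreal_root b c r) ^ (m + 2) * cmod (nonreal_root b c r - complex_of_real r) * sin (phase b c m r)"
proof -
  let ?X = "nonreal_root b c r" and ?Y = "nonreal_root b c r - complex_of_real r"
  have "cnj ?X - of_real r = cnj ?Y" by simp
  also have "\<dots> = of_real (cmod ?Y) * cis (- upper_arg ?Y)"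
    by (subst upper_arg_polar[of ?Y, symmetric]) (simp add: cis_cnj del: upper_arg_polar)
  finally have 1: "cnj ?X - of_real r = of_real (cmod ?Y) * cis (- upper_arg ?Y)" .
  have "?X ^ (m + 2) = (of_real (cmod ?X) * cis (upper_arg ?X)) ^ (m + 2)"
    unfolding upper_arg_polar ..
  also have "\<dots> = of_real (cmod ?X ^ (m + 2)) * cis (real (m + 2) * upper_arg ?X)"
    unfolding power_mult_distrib Complex.DeMoivre of_real_power ..
  finally have "?X ^ (m + 2) = of_real (cmod ?X ^ (m + 2)) * cis (real (m + 2) * upper_arg ?X)" .
  with 1 have "?X ^ (m + 2) * (cnj ?X - of_real r) = 
     of_real (cmod ?X ^ (m + 2) * cmod ?Y) * (cis (real (m + 2) * upper_arg ?X) * cis (- upper_arg ?Y))"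
    by (simp only: of_real_mult mult_ac)
  also have "\<dots> = of_real (cmod ?X ^ (m + 2) * cmod ?Y) * cis (phase b c m r)"
    by (simp add: cis_mult phase_def algebra_simps)
  finally show ?thesis by (simp only:) simp
qed

text \<open>For the roots X, cnj X, r the Vandermonde product is 2 i Im X |X - r|^2, and the terms
  of X and cnj X combine to W - cnj W = 2 i Im W. The common factor 2 i cancels and a real identity
  is left.\<close>

lemma H_osc:
  assumes "disc b c r > 0"
  shows "poly (H b c m) (of_real (root_param b c r))
      * of_real ((cmod (nonreal_root b c r - complex_of_real r))^2 * Im (nonreal_root b c r)) = of_real (osc b c m r)"
proof -
  let ?X = "nonreal_root b c r"
  let ?P = "poly (H b c m) (of_real (root_param b c r))"
  have re: "?X + cnj ?X = of_real (- (c + r))"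
    unfolding complex_add_cnj nonreal_root_def by simp
  have pr: "?X * cnj ?X = of_real (r^2 + (b + c * r))"
    using cmod_nonreal_root[of b c r] assms by (simp flip: complex_norm_square)
  have V: "?P * ((?X - cnj ?X) * (cnj ?X - of_real r) * (?X - of_real r))
       = ?X ^ (m + 2) * (cnj ?X - of_real r) - cnj ?X ^ (m + 2) * (?X - of_real r) + of_real r ^ (m + 2) * (?X - cnj ?X)"
  proof (rule H_vandermonde)
    show "?X + cnj ?X + of_real r = - of_real c" unfolding re by simp
    have "?X * cnj ?X + cnj ?X * of_real r + ?X * of_real r = ?X * cnj ?X + (?X + cnj ?X) * of_real r"
      by (simp add: algebra_simps)
    also have "\<dots> = of_real b" unfolding re pr by (simp add: algebra_simps power2_eq_square)
    finally show "?X * cnj ?X + cnj ?X * of_real r + ?X * of_real r = of_real b" .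
    show "?X * cnj ?X * of_real r = - of_real (root_param b c r)"
      unfolding pr root_param_def by (simp add: algebra_simps power2_eq_square power3_eq_cube)
  qed
  have n: "(cnj ?X - of_real r) * (?X - of_real r) = of_real ((cmod (?X - of_real r))^2)"
    using complex_norm_square[of "?X - of_real r"] by (simp add: mult.commute)
  have i: "?X - cnj ?X = 2 * \<i> * of_real (Im ?X)" by (simp add: complex_diff_cnj)
  let ?W = "?X ^ (m + 2) * (cnj ?X - of_real r)"
  have "?X ^ (m + 2) * (cnj ?X - of_real r) - cnj ?X ^ (m + 2) * (?X - of_real r) = ?W - cnj ?W" by simp
  also have "\<dots> = 2 * \<i> * of_real (Im ?W)" by (simp only: complex_diff_cnj mult_ac of_real_mult of_real_numeral)
  finally have w: "?X ^ (m + 2) * (cnj ?X - of_real r) - cnj ?X ^ (m + 2) * (?X - of_real r) = 2 * \<i> * of_real (Im ?W)" .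
  have "?P * ((2 * \<i> * of_real (Im ?X)) * of_real ((cmod (?X - of_real r))^2)) 
      = 2 * \<i> * of_real (Im ?W) + of_real r ^ (m + 2) * (2 * \<i> * of_real (Im ?X))"
    using V unfolding w unfolding i mult.assoc n .
  then have "2 * \<i> * (?P * of_real ((cmod (?X - of_real r))^2 * Im ?X)) = 2 * \<i> * of_real (osc b c m r)"
    unfolding osc_def osc_eq_Im[symmetric] of_real_add of_real_mult of_real_power by (simp add: algebra_simps)
  then show ?thesis by simp
qed

lemma H_zero_iff_osc:
  assumes "disc b c r > 0"
  shows "poly (H b c m) (of_real (root_param b c r)) = 0 \<longleftrightarrow> osc b c m r = 0"
proof -
  have "(cmod (nonreal_root b c r - complex_of_real r))^2 * Im (nonreal_root b c r) \<noteq> 0"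
    using Im_nonreal_root[OF assms] by (auto simp: complex_eq_iff)
  then show ?thesis using H_osc[OF assms, of m] 
    by (metis mult_eq_0_iff of_real_eq_0_iff)
qed

text \<open>The sine is (-1)^k here and its coefficient wins: |r| < |X| by dominance, and Im X \<le>
  |X - r| because r is real.\<close>

lemma osc_sign:
  assumes "r \<in> pair_dominant b c" "phase b c m r = pi / 2 + real k * pi"
  shows "(-1) ^ k * osc b c m r > 0"
proof -
  let ?X = "nonreal_root b c r"
  have d: "disc b c r > 0" "b + c * r > 0" using assms by (auto simp: pair_dominant_def)
  have i: "Im ?X > 0" using Im_nonreal_root[OF d(1)] .
  have "\<bar>r\<bar>\<^sup>2 < (cmod ?X)^2" using cmod_nonreal_root[of b c r] d by simp
  then have lt: "\<bar>r\<bar> < cmod ?X" using power2_less_imp_less norm_ge_zero by blast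
  have "sin (phase b c m r) = (-1) ^ k"
    unfolding assms(2) by (simp add: sin_add)
  then have "(-1) ^ k * osc b c m r = (-1) ^ k * r ^ (m + 2) * Im ?X 
      + cmod ?X ^ (m + 2) * cmod (?X - of_real r)"
    unfolding osc_def by (simp add: algebra_simps flip: power_mult_distrib)
  moreover have "\<bar>(-1) ^ k * r ^ (m + 2) * Im ?X\<bar> < cmod ?X ^ (m + 2) * cmod (?X - of_real r)"
  proof -
    have "\<bar>(-1) ^ k * r ^ (m + 2) * Im ?X\<bar> = \<bar>r\<bar> ^ (m + 2) * Im ?X"
      using i by (simp add: abs_mult power_abs)
    also have "\<dots> < cmod ?X ^ (m + 2) * Im ?X"
      using i power_strict_mono[OF lt, of "m + 2"] by simp
    also have "\<dots> \<le> cmod ?X ^ (m + 2) * cmod (?X - of_real r)"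
      using abs_Im_le_cmod[of "?X - of_real r"] i by (intro mult_left_mono) auto
    finally show ?thesis .
  qed
  ultimately show ?thesis by linarith
qed

lemma continuous_nonreal_root: "isCont (nonreal_root b c) r"
  unfolding nonreal_root_def[abs_def] disc_def[abs_def] Complex_eq
  by (intro continuous_intros) auto

lemma isCont_Im_nonreal_root: "isCont (\<lambda>r. Im (nonreal_root b c r)) r"
  using continuous_Im[OF continuous_nonreal_root] by simp

lemma isCont_phase:
  assumes "disc b c r > 0"
  shows "isCont (phase b c m) r"
  unfolding phase_def[abs_def] using Im_nonreal_root[OF assms]
  by (intro continuous_intros isCont_o2[OF _ isCont_upper_arg] continuous_nonreal_root) auto

lemma isCont_osc:
  assumes "disc b c r > 0"
  shows "isCont (osc b c m) r"
  unfolding osc_def[abs_def]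
  by (intro continuous_intros isCont_phase continuous_nonreal_root isCont_Im_nonreal_root assms)

text \<open>The cofactor of r - r' is the quadratic left after dividing out r, evaluated at r'; its
  discriminant is negative, so it is positive. Distinct zeros of \<open>osc\<close> therefore give
  distinct zeros of H_m.\<close>

lemma inj_on_root_param: "inj_on (root_param b c) {r. disc b c r > 0}"
proof (rule inj_onI)
  fix r r' assume r: "r \<in> {r. disc b c r > 0}" and e: "root_param b c r = root_param b c r'"
  have "(r - r') * (r^2 + r * r' + r'^2 + c * (r + r') + b) = 0"
    using e unfolding root_param_def by (simp add: algebra_simps power2_eq_square power3_eq_cube)
  moreover have "r^2 + r * r' + r'^2 + c * (r + r') + b = (r' + (r + c) / 2)^2 + disc b c r / 4"
    by (simp add: disc_def field_simps power2_eq_square)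
  then have "r^2 + r * r' + r'^2 + c * (r + r') + b > 0"
    using r by (simp add: add_nonneg_pos)
  ultimately show "r = r'" by simp
qed

text \<open>For large r the cubic is close to x^3 = r^3, so X / r tends to cis (2 pi / 3). The
  function \<open>g\<close> is X / r in terms of t = 1 / r, which extends continuously to t =
  0.\<close>

lemma phase_at_top: "(phase b c m \<longlongrightarrow> (4 * real m + 3) * pi / 6) at_top"
proof -
  define g where "g t = Complex (- (c * t + 1) / 2) (sqrt (3 + 2 * c * t + (4 * b - c^2) * t^2) / 2)" for t
  have cg: "isCont g 0" unfolding g_def[abs_def] Complex_eq by (intro continuous_intros) auto
  have g0: "g 0 = cis (2 * pi / 3)" "g 0 - 1 = of_real (sqrt 3) * cis (5 * pi / 6)"
  proof -
    have e: "2 * pi / 3 = pi / 2 + pi / 6" "5 * pi / 6 = pi / 2 + pi / 3" by simp_all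
    have "cos (2 * pi / 3) = - 1 / 2" "sin (2 * pi / 3) = sqrt 3 / 2"
        "cos (5 * pi / 6) = - sqrt 3 / 2" "sin (5 * pi / 6) = 1 / 2"
      unfolding e cos_add sin_add by (simp_all add: cos_30 sin_30 cos_60 sin_60)
    then show "g 0 = cis (2 * pi / 3)" "g 0 - 1 = of_real (sqrt 3) * cis (5 * pi / 6)"
      by (simp_all add: g_def complex_eq_iff)
  qed
  have u: "upper_arg (g 0) = 2 * pi / 3" "upper_arg (g 0 - 1) = 5 * pi / 6"
    unfolding g0(2) unfolding g0(1) by (simp_all add: upper_arg_scale upper_arg_cis)
  have "isCont (\<lambda>t. (real m + 2) * upper_arg (g t) - upper_arg (g t - 1)) 0"
    by (intro continuous_intros isCont_o2[OF _ isCont_upper_arg] cg) (auto simp: g_def)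
  then have "((\<lambda>t. (real m + 2) * upper_arg (g t) - upper_arg (g t - 1)) \<longlongrightarrow> 
      (real m + 2) * upper_arg (g 0) - upper_arg (g 0 - 1)) (nhds 0)"
    unfolding isCont_def tendsto_at_iff_tendsto_nhds[where g = "\<lambda>t. (real m + 2) * upper_arg (g t) - upper_arg (g t - 1)"] .
  then have "((\<lambda>r. (real m + 2) * upper_arg (g (inverse r)) - upper_arg (g (inverse r) - 1)) \<longlongrightarrow> 
      (real m + 2) * upper_arg (g 0) - upper_arg (g 0 - 1)) at_top"
    using tendsto_inverse_0_at_top[OF filterlim_ident] by (rule filterlim_compose)
  moreover have "\<forall>\<^sub>F r in at_top. (real m + 2) * upper_arg (g (inverse r)) - upper_arg (g (inverse r) - 1) = phase b c m r"
    using eventually_gt_at_top[of "0::real"]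
  proof eventually_elim
    case (elim r)
    have e1: "nonreal_root b c r = of_real r * g (inverse r)"
    proof -
      have "disc b c r = r^2 * (3 + 2 * c * inverse r + (4 * b - c^2) * (inverse r)^2)"
        using elim by (simp add: disc_def field_simps power2_eq_square)
      then have "sqrt (disc b c r) = r * sqrt (3 + 2 * c * inverse r + (4 * b - c^2) * (inverse r)^2)"
        using elim by (simp add: real_sqrt_mult)
      then show ?thesis using elim by (simp add: nonreal_root_def g_def complex_eq_iff field_simps)
    qed
    have e2: "nonreal_root b c r - of_real r = of_real r * (g (inverse r) - 1)"
      unfolding e1 by (simp add: algebra_simps)
    show ?case unfolding phase_def e2 unfolding e1 using elim by (simp add: upper_arg_scale)
  qed
  ultimately have "(phase b c m \<longlongrightarrow> (real m + 2) * upper_arg (g 0) - upper_arg (g 0 - 1)) at_top"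
    using tendsto_cong by force
  also have "(real m + 2) * upper_arg (g 0) - upper_arg (g 0 - 1) = (4 * real m + 3) * pi / 6"
    unfolding u by (simp add: field_simps)
  finally show ?thesis .
qed

subsection \<open>Counting sign changes\<close>

lemma IVT_between:
  fixes f :: "real \<Rightarrow> real"
  assumes "u \<le> v" "continuous_on {u..v} f" "f u \<le> y \<and> y \<le> f v \<or> f v \<le> y \<and> y \<le> f u"
  obtains x where "u \<le> x" "x \<le> v" "f x = y"
  using assms IVT'[of f u y v] IVT2'[of f v y u] by blast

text \<open>
  The end points are only required to have the right sign of G: at infinity the phase reaches an odd
  multiple of pi/2 only in the limit when 3 divides m.
\<close>

lemma sign_changes:
  fixes \<Phi> G :: "real \<Rightarrow> real" and K J :: nat
  assumes "continuous_on {u..v} \<Phi>" "continuous_on {u..v} G"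
    and "\<And>r k::nat. r \<in> {u..v} \<Longrightarrow> \<Phi> r = pi / 2 + real k * pi \<Longrightarrow> (-1) ^ k * G r > 0"
    and "u \<le> v" "(-1) ^ K * G u > 0" "(-1) ^ J * G v > 0"
    and "\<Phi> u > pi / 2 + (real K - 1) * pi" "\<Phi> v < pi / 2 + (real J + 1) * pi" "J \<le> K"
  shows "\<exists>A. A \<subseteq> {u<..<v} \<and> finite A \<and> card A = K - J \<and> (\<forall>r\<in>A. G r = 0)"
  using assms
proof (induction "K - J" arbitrary: u K)
  case 0
  then show ?case by (intro exI[of _ "{}"]) auto
next
  case (Suc n)
  have root: "\<exists>x. s < x \<and> x < t \<and> G x = 0" if st: "u \<le> s" "s \<le> t" "t \<le> v" "G s * G t < 0" for s t
  proof -
    have "continuous_on {s..t} G" using Suc.prems(2) by (rule continuous_on_subset) (use st in auto)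
    moreover have "G s \<le> 0 \<and> 0 \<le> G t \<or> G t \<le> 0 \<and> 0 \<le> G s"
      using st(4) by (auto simp: mult_less_0_iff)
    ultimately obtain x where x: "s \<le> x" "x \<le> t" "G x = 0"
      using IVT_between[of s t G 0] st(2) by blast
    moreover have "x \<noteq> s" "x \<noteq> t" using x st by auto
    ultimately show ?thesis by (intro exI[of _ x]) auto
  qed
  \<comment> \<open>The next sign witness: a point of phase pi/2 + (K - 1) pi, from which the
    induction restarts, or \<open>v\<close> once a single zero is missing.\<close>
  obtain t where t: "u \<le> t" "t \<le> v" "(-1) ^ (K - 1) * G t > 0" "t = v \<and> n = 0 \<or> \<Phi> t = pi / 2 + real (K - 1) * pi"
  proof (cases "n = 0")
    case True
    then have "K - 1 = J" using Suc.hyps Suc.prems by linarith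
    then show ?thesis using that[of v] Suc.prems True by auto
  next
    case False
    then have KJ: "real J + 1 \<le> real (K - 1)" "real (K - 1) = real K - 1" using Suc.hyps Suc.prems by linarith+
    then have "(real J + 1) * pi \<le> real (K - 1) * pi" by (intro mult_right_mono) auto
    then have "\<Phi> v \<le> pi / 2 + real (K - 1) * pi" using Suc.prems(8) by linarith
    moreover have "pi / 2 + real (K - 1) * pi \<le> \<Phi> u" using Suc.prems(7) KJ(2) by simp
    ultimately obtain t where t: "u \<le> t" "t \<le> v" "\<Phi> t = pi / 2 + real (K - 1) * pi"
      using IVT_between[of u v \<Phi> "pi / 2 + real (K - 1) * pi"] Suc.prems(1,4) by blast
    then show ?thesis using that[of t] Suc.prems(3)[of t "K - 1"] by auto
  qed
  have K: "K = Suc (K - 1)" using Suc.hyps by linarith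
  have "(-1) ^ K * G u > 0" using Suc.prems by simp
  then have "(-1) ^ (K - 1) * G u < 0" by (subst (asm) K) simp
  then have "((-1) ^ (K - 1) * G u) * ((-1) ^ (K - 1) * G t) < 0" using t(3) by (rule mult_neg_pos)
  moreover have "(-1::real) ^ (K - 1) = 1 \<or> (-1::real) ^ (K - 1) = - 1" by (simp add: minus_one_power_iff)
  ultimately have "G u * G t < 0" by auto
  then obtain x where x: "u < x" "x < t" "G x = 0" using root[of u t] t by auto
  have "\<exists>A. A \<subseteq> {t<..<v} \<and> finite A \<and> card A = K - 1 - J \<and> (\<forall>r\<in>A. G r = 0)"
  proof (cases "n = 0")
    case True
    then show ?thesis using Suc.hyps by (intro exI[of _ "{}"]) auto
  next
    case False
    show ?thesis
    proof (rule Suc.hyps(1))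
      show "n = K - 1 - J" using Suc.hyps by linarith
      show "continuous_on {t..v} \<Phi>" "continuous_on {t..v} G"
        using Suc.prems(1,2) t by (auto elim!: continuous_on_subset)
      show "pi / 2 + (real (K - 1) - 1) * pi < \<Phi> t" using t False by (simp add: algebra_simps)
      show "J \<le> K - 1" using Suc.hyps by linarith
    qed (use Suc.prems t in auto)
  qed
  then obtain A where A: "A \<subseteq> {t<..<v}" "finite A" "card A = K - 1 - J" "\<forall>r\<in>A. G r = 0" by blast
  have "x \<notin> A" using A x by auto
  then have "card (insert x A) = K - J" using A Suc.hyps by simp
  then show ?case using A x t by (intro exI[of _ "insert x A"]) auto
qed

section \<open>From zeros of \<open>osc\<close> to real zeros of H_m, and the reflection r -> -r for
  c = 0\<close>

lemma zeros_realI: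
  assumes "finite A" "degree p \<le> card A" "\<And>x. x \<in> A \<Longrightarrow> poly p (complex_of_real x) = 0"
  shows "zeros_real p"
proof (cases "p = 0")
  case False
  have fin: "finite {z. poly p z = 0}" using False by (rule poly_roots_finite)
  have sub: "complex_of_real ` A \<subseteq> {z. poly p z = 0}" using assms by auto
  have "card {z. poly p z = 0} \<le> card (complex_of_real ` A)"
    using card_poly_roots_bound[OF False] assms(2) by (subst card_image) (auto simp: inj_on_def)
  then have "complex_of_real ` A = {z. poly p z = 0}"
    using card_seteq[OF fin sub] by simp
  then show ?thesis unfolding zeros_real_def by (metis (mono_tags) Im_complex_of_real imageE mem_Collect_eq)
qed (simp add: zeros_real_def)

lemma zeros_real_oscI:
  assumes "finite A" "A \<subseteq> {r. disc b c r > 0}" "\<And>r. r \<in> A \<Longrightarrow> osc b c m r = 0" "degree (H b c m) \<le> card A"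
  shows "zeros_real (H b c m)"
proof (rule zeros_realI)
  show "finite (root_param b c ` A)" using assms by simp
  have "inj_on (root_param b c) A" using inj_on_root_param assms(2) by (rule inj_on_subset)
  then show "degree (H b c m) \<le> card (root_param b c ` A)" using assms(4) by (simp add: card_image)
  show "poly (H b c m) (complex_of_real x) = 0" if x: "x \<in> root_param b c ` A" for x
    using x assms(2,3) H_zero_iff_osc by blast
qed

lemma continuous_on_phase: "S \<subseteq> {r. disc b c r > 0} \<Longrightarrow> continuous_on S (phase b c m)"
  using isCont_phase by (intro continuous_at_imp_continuous_on) auto

lemma continuous_on_osc: "S \<subseteq> {r. disc b c r > 0} \<Longrightarrow> continuous_on S (osc b c m)"
  using isCont_osc by (intro continuous_at_imp_continuous_on) auto

lemma upper_arg_neg_cnj: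
  assumes "Im w > 0"
  shows "upper_arg (- cnj w) = pi - upper_arg w"
proof -
  let ?z = "- \<i> * w"
  have nz: "?z \<noteq> 0" "?z \<notin> \<real>\<^sub>\<le>\<^sub>0" using assms by (auto simp: complex_nonpos_Reals_iff)
  have "Arg (- \<i> * - cnj w) = Arg (cnj ?z)" by simp
  also have "\<dots> = Im (Ln (cnj ?z))" using nz by (intro Arg_eq_Im_Ln) auto
  also have "\<dots> = - Im (Ln ?z)" using cnj_Ln[OF nz(2)] by (metis cnj.simps(2))
  also have "\<dots> = - Arg ?z" using nz by (simp add: Arg_eq_Im_Ln)
  finally show ?thesis unfolding upper_arg_def by simp
qed

text \<open>For c = 0 the cubic belonging to -r has the negated roots, so X and X - r are reflected
  in the imaginary axis and both arguments become their supplements. In particular the phase at r =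
  0 is (m + 1) pi / 2.\<close>

lemma phase_neg:
  assumes "disc b 0 r > 0"
  shows "phase b 0 m (- r) = (real m + 1) * pi - phase b 0 m r"
proof -
  have "nonreal_root b 0 (- r) = - cnj (nonreal_root b 0 r)"
    by (simp add: nonreal_root_def disc_def complex_eq_iff)
  moreover have "nonreal_root b 0 (- r) - of_real (- r) = - cnj (nonreal_root b 0 r - of_real r)"
    by (simp add: nonreal_root_def disc_def complex_eq_iff)
  moreover have "upper_arg (- cnj (nonreal_root b 0 r)) = pi - upper_arg (nonreal_root b 0 r)"
    "upper_arg (- cnj (nonreal_root b 0 r - of_real r)) = pi - upper_arg (nonreal_root b 0 r - of_real r)"
    using Im_nonreal_root[OF assms] by (intro upper_arg_neg_cnj; simp)+
  ultimately show ?thesis unfolding phase_def by (simp only:) (simp add: algebra_simps)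
qed

lemma osc_neg:
  assumes "disc b 0 r > 0"
  shows "osc b 0 m (- r) = (- 1) ^ m * osc b 0 m r"
proof -
  have e1: "nonreal_root b 0 (- r) = - cnj (nonreal_root b 0 r)"
    by (simp add: nonreal_root_def disc_def complex_eq_iff)
  have e2: "nonreal_root b 0 (- r) - of_real (- r) = - cnj (nonreal_root b 0 r - of_real r)"
    by (simp add: nonreal_root_def disc_def complex_eq_iff)
  have "sin (phase b 0 m (- r)) = (- 1) ^ m * sin (phase b 0 m r)"
    unfolding phase_neg[OF assms] using sin_npi[of "m+1"] cos_npi[of "m+1"]
    by (simp add: sin_diff add.commute)
  moreover have "(- r) ^ (m + 2) = (-1) ^ m * r ^ (m + 2)" using power_mult_distrib[of "-1" r "m + 2"] by simp
  ultimately show ?thesis unfolding osc_def e2 unfolding e1 norm_minus_cancel complex_mod_cnj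
    by (simp only: distrib_left mult_ac) simp
qed

subsection \<open>Real zeros\<close>

text \<open>With w = sqrt (1 - 3 a), the bound on r is the larger root of \<open>disc\<close>, and
  beyond it 3 (a + r) > w (2 - w). The hypotheses on a say exactly that w is the root of a
  nonnegative number and that w \<le> 2.\<close>

lemma pair_dominant_c1:
  assumes "-1 \<le> a" "a \<le> 1/3" "r > (2 * sqrt (1 - 3 * a) - 1) / 3"
  shows "r \<in> pair_dominant a 1"
proof -
  define w where "w = sqrt (1 - 3 * a)"
  have w: "w \<ge> 0" "w \<le> 2" "w^2 = 1 - 3 * a"
    using assms real_sqrt_le_mono[of "1 - 3 * a" "2^2"] by (auto simp: w_def)
  have "disc a 1 r = (3 * r + 1 - 2 * w) * (3 * r + 1 + 2 * w) / 3"
    using w(3) by (simp add: disc_def field_simps power2_eq_square)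
  moreover have "3 * r + 1 - 2 * w > 0" "3 * r + 1 + 2 * w > 0" using assms(3) w unfolding w_def[symmetric] by auto
  ultimately have d: "disc a 1 r > 0" by (metis mult_pos_pos divide_pos_pos zero_less_numeral)
  have "3 * (a + r) > w * (2 - w)"
    using assms(3) w unfolding w_def[symmetric] by (simp add: algebra_simps power2_eq_square)
  moreover have "w * (2 - w) \<ge> 0" using w by (intro mult_nonneg_nonneg) auto
  ultimately have "3 * (a + r) > 0" by (rule le_less_trans[rotated])
  then have "a + r > 0" by simp
  then show ?thesis using d by (simp add: pair_dominant_def)
qed

lemma pair_dominant_c0: "b > 0 \<Longrightarrow> r \<in> pair_dominant b 0"
  by (simp add: pair_dominant_def disc_def add_nonneg_pos)

text \<open>As r decreases to the end of the range, X tends to the negative double root -(1 + w) /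
  3, so its argument tends to pi. The argument of X - r is only bounded by pi, since X - r tends to
  -w, which is 0 for a = 1/3.\<close>

lemma phase_left_end:
  assumes "-1 \<le> a" "a \<le> 1/3"
  obtains u where "u > (2 * sqrt (1 - 3 * a) - 1) / 3" "phase a 1 m u > pi / 2 + real m * pi"
proof -
  define w where "w = sqrt (1 - 3 * a)"
  define l where "l = (2 * w - 1) / 3"
  have w: "w \<ge> 0" "w^2 = 1 - 3 * a" using assms by (auto simp: w_def)
  have "disc a 1 l = 0" using w(2) by (simp add: disc_def l_def field_simps power2_eq_square)
  then have "nonreal_root a 1 l = of_real ((1 + w) / 3) * cis pi"
    by (simp add: nonreal_root_def complex_eq_iff l_def field_simps)
  then have ua: "upper_arg (nonreal_root a 1 l) = pi" "Re (nonreal_root a 1 l) \<noteq> 0"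
    using w(1) by (simp_all only: upper_arg_scale upper_arg_cis) (auto simp: upper_arg_scale upper_arg_cis simp del: of_real_divide of_real_add cis_pi)
  have "isCont (\<lambda>r. (real m + 2) * upper_arg (nonreal_root a 1 r)) l"
    by (intro continuous_intros isCont_o2[OF _ isCont_upper_arg] continuous_nonreal_root) (use ua in auto)
  moreover have "(real m + 2) * upper_arg (nonreal_root a 1 l) > (real m + 2) * pi - pi / 2"
    unfolding ua by simp
  ultimately have "\<forall>\<^sub>F r in at l. (real m + 2) * upper_arg (nonreal_root a 1 r) > (real m + 2) * pi - pi / 2"
    unfolding isCont_def by (rule order_tendstoD)
  then have "\<forall>\<^sub>F r in at_right l. (real m + 2) * upper_arg (nonreal_root a 1 r) > (real m + 2) * pi - pi / 2"
    by (simp add: eventually_at_split)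
  moreover have "\<forall>\<^sub>F r in at_right l. r > l" by (rule eventually_at_right_less)
  ultimately have "\<forall>\<^sub>F r in at_right l. r > l \<and> phase a 1 m r > pi / 2 + real m * pi"
  proof eventually_elim
    case (elim r)
    then have "disc a 1 r > 0" using pair_dominant_c1[OF assms] unfolding l_def w_def pair_dominant_def by auto
    then have "Im (nonreal_root a 1 r - of_real r) > 0" using Im_nonreal_root by simp
    then have "upper_arg (nonreal_root a 1 r - of_real r) < pi" by (rule upper_arg_bounds)
    then have "phase a 1 m r > pi / 2 + real m * pi"
      using elim(1) unfolding phase_def distrib_right by linarith
    then show ?case using elim by simp
  qed
  then have "\<exists>r. r > l \<and> phase a 1 m r > pi / 2 + real m * pi" 
    using eventually_happens trivial_limit_at_right_real by blast
  then show ?thesis using that unfolding l_def w_def by blast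
qed

lemma phase_right_end:
  obtains v where "v > x" "v > 0" "(4 * real m + 2) * pi / 6 < phase b c m v" "phase b c m v < (4 * real m + 4) * pi / 6"
proof -
  have "(4 * real m + 2) * pi / 6 < (4 * real m + 3) * pi / 6" "(4 * real m + 3) * pi / 6 < (4 * real m + 4) * pi / 6"
    by (simp_all add: field_simps)
  then have "\<forall>\<^sub>F v in at_top. v > x \<and> v > 0 \<and> (4 * real m + 2) * pi / 6 < phase b c m v \<and> phase b c m v < (4 * real m + 4) * pi / 6"
    by (intro eventually_conj order_tendstoD[OF phase_at_top] eventually_gt_at_top)
  then show ?thesis using that eventually_happens trivial_limit_at_top_linorder by blast
qed

text \<open>The limit phase (4 m + 3) pi / 6 equals 2 n pi + pi / 2 for m = 3 n; within pi / 6 of it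
  the sine is positive, and so is the term with r.\<close>

lemma osc_right_end:
  assumes "m = 3 * n" "v > 0" "disc b c v > 0"
    "(4 * real m + 2) * pi / 6 < phase b c m v" "phase b c m v < (4 * real m + 4) * pi / 6"
  shows "osc b c m v > 0"
proof -
  have m: "real m = 3 * real n" using assms(1) by simp
  define t where "t = phase b c m v - 2 * pi * real n"
  have "0 < t" "t < pi" using assms(4,5) pi_gt_zero unfolding t_def m by (simp_all add: field_simps)
  then have "sin t > 0" by (rule sin_gt_zero)
  moreover have "sin (phase b c m v) = sin t"
    using sin_add[of t "2 * pi * real n"] sin_2npi[of n] cos_2npi[of n] unfolding t_def
    by (simp add: mult_ac)
  ultimately show ?thesis unfolding osc_def using assms(2) Im_nonreal_root[OF assms(3)]
    by (intro add_pos_nonneg mult_pos_pos mult_nonneg_nonneg) auto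
qed

text \<open>Sign witnesses of index m near the left end and m - m div 3 far to the right enclose m
  div 3 zeros of \<open>osc\<close>, as many as \<open>degree_H\<close> allows.\<close>

lemma zeros_real_c1:
  assumes "-1 \<le> a" "a \<le> 1/3"
  shows "zeros_real (H a 1 m)"
proof (cases "m = 0")
  case True
  then show ?thesis by (simp add: zeros_real_def)
next
  case m: False
  define l where "l = (2 * sqrt (1 - 3 * a) - 1) / 3"
  have pd: "r \<in> pair_dominant a 1" "disc a 1 r > 0" if "r > l" for r
    using pair_dominant_c1[OF assms] that unfolding l_def by (auto simp: pair_dominant_def)
  obtain u0 where u0: "u0 > l" "phase a 1 m u0 > pi / 2 + real m * pi"
    using phase_left_end[OF assms] unfolding l_def by blast
  obtain v0 where v0: "v0 > u0" "v0 > 0" "(4 * real m + 2) * pi / 6 < phase a 1 m v0" "phase a 1 m v0 < (4 * real m + 4) * pi / 6"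
    by (rule phase_right_end)
  have ex: "\<exists>x. s \<le> x \<and> x \<le> v0 \<and> phase a 1 m x = y" if "u0 \<le> s" "s \<le> v0" "phase a 1 m v0 \<le> y" "y \<le> phase a 1 m s" for s y
  proof -
    have "{s..v0} \<subseteq> {r. disc a 1 r > 0}" using that(1) u0(1) pd by auto
    then have "continuous_on {s..v0} (phase a 1 m)" by (rule continuous_on_phase)
    then show ?thesis using IVT_between[of s v0 "phase a 1 m" y] that by metis
  qed
  have "(4 * real m + 4) * pi / 6 \<le> pi / 2 + real m * pi" using m by (simp add: field_simps)
  then obtain u where u: "u0 \<le> u" "u \<le> v0" "phase a 1 m u = pi / 2 + real m * pi"
    using ex[of u0 "pi / 2 + real m * pi"] u0 v0 by auto
  have "\<exists>v J. u \<le> v \<and> (-1) ^ J * osc a 1 m v > 0 \<and> phase a 1 m v < pi / 2 + (real J + 1) * pi \<and> J + m div 3 = m"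
  proof (cases "m mod 3 = 0")
    case True
    then obtain n where n: "m = 3 * n" by auto
    have "osc a 1 m v0 > 0" using osc_right_end[OF n v0(2) _ v0(3,4)] pd u0 v0 by auto
    moreover have "phase a 1 m v0 < pi / 2 + (real (2 * n) + 1) * pi"
      using v0(4) unfolding n by (simp add: field_simps) (insert pi_gt_zero, linarith)
    ultimately show ?thesis using u n by (intro exI[of _ v0] exI[of _ "2 * n"]) auto
  next
    case False
    \<comment> \<open>If 3 does not divide m, then 6 J > 4 m, so pi/2 + J pi lies above the limit (4
      m + 3) pi / 6 and the phase attains it before \<open>v0\<close>.\<close>
    define J where "J = m - m div 3"
    have J: "J + m div 3 = m" "4 * m + 1 \<le> 6 * J" "J \<le> m" unfolding J_def using False by presburger+
    have r: "real J \<le> real m" "4 * real m + 1 \<le> 6 * real J" using J by linarith+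
    have "(4 * real m + 4) * pi / 6 \<le> pi / 2 + real J * pi"
      using r(2) mult_right_mono[of "4 * real m + 1" "6 * real J" pi] by (simp add: field_simps)
    moreover have "real J * pi \<le> real m * pi" using r by (intro mult_right_mono) auto
    ultimately obtain v where v: "u \<le> v" "v \<le> v0" "phase a 1 m v = pi / 2 + real J * pi"
      using ex[of u "pi / 2 + real J * pi"] u v0 by auto
    have "(-1) ^ J * osc a 1 m v > 0" using osc_sign[OF _ v(3)] pd u0 u v by auto
    then show ?thesis using v J by (intro exI[of _ v] exI[of _ J]) (auto simp: distrib_right)
  qed
  then obtain v J where v: "u \<le> v" "(-1) ^ J * osc a 1 m v > 0" "phase a 1 m v < pi / 2 + (real J + 1) * pi" "J + m div 3 = m"
    by blast
  have D: "{u..v} \<subseteq> {r. disc a 1 r > 0}" "{u..v} \<subseteq> pair_dominant a 1" using u u0 pd by auto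
  have "\<exists>A. A \<subseteq> {u<..<v} \<and> finite A \<and> card A = m - J \<and> (\<forall>r\<in>A. osc a 1 m r = 0)"
  proof (rule sign_changes[where \<Phi> = "phase a 1 m"])
    show "(-1) ^ m * osc a 1 m u > 0" using osc_sign[OF _ u(3)] D v by auto
    show "pi / 2 + (real m - 1) * pi < phase a 1 m u" unfolding u(3) by (simp add: algebra_simps)
  qed (use v D osc_sign continuous_on_phase continuous_on_osc in auto)
  then obtain A where A: "A \<subseteq> {u<..<v}" "finite A" "card A = m - J" "\<forall>r\<in>A. osc a 1 m r = 0" by blast
  show ?thesis
  proof (rule zeros_real_oscI)
    have "{u<..<v} \<subseteq> {u..v}" by auto
    then show "A \<subseteq> {r. disc a 1 r > 0}" using A(1) D(1) by (meson order_trans)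
    show "degree (H a 1 m) \<le> card A" using A v degree_H[of a 1 m] by linarith
  qed (use A in auto)
qed

text \<open>Here the phase is larger at v than at -v, so the count runs over
  \<open>phase b 0 m (- r)\<close>. By \<open>phase_neg\<close> an index K at v turns into m - K at
  -v, which leaves 2 K - m zeros in between. K = 2 n, 2 n, 2 n + 1 for m = 3 n, 3 n + 1, 3 n + 2
  gives n, n - 1, n, the degree bounds.\<close>

lemma zeros_real_c0:
  assumes "b > 0"
  shows "zeros_real (H b 0 m)"
proof -
  have pd: "r \<in> pair_dominant b 0" "disc b 0 r > 0" for r
    using pair_dominant_c0[OF assms] by (auto simp: pair_dominant_def)
  have half: "phase b 0 m 0 = (real m + 1) * pi / 2" using phase_neg[OF pd(2), where r = 0 and m = m] by simp
  obtain v0 where v0: "v0 > 0" "(4 * real m + 2) * pi / 6 < phase b 0 m v0" "phase b 0 m v0 < (4 * real m + 4) * pi / 6"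
    by (rule phase_right_end)
  have concl: "zeros_real (H b 0 m)" 
    if v: "v \<ge> 0" "(-1) ^ K * osc b 0 m v > 0" "pi / 2 + (real K - 1) * pi < phase b 0 m v"
      and J: "(-1) ^ (m + J) * osc b 0 m v > 0" "(real m - real J) * pi - pi / 2 < phase b 0 m v"
      and d: "J \<le> K" "degree (H b 0 m) \<le> K - J" for v K J
  proof -
    have "\<exists>A. A \<subseteq> {-v<..<v} \<and> finite A \<and> card A = K - J \<and> (\<forall>r\<in>A. osc b 0 m (- r) = 0)"
    proof (rule sign_changes[where \<Phi> = "\<lambda>r. phase b 0 m (- r)"])
      show "continuous_on {- v..v} (\<lambda>r. phase b 0 m (- r))" "continuous_on {- v..v} (\<lambda>r. osc b 0 m (- r))"
        using continuous_on_phase[of UNIV b 0 m] continuous_on_osc[of UNIV b 0 m] pd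
        by (auto intro!: continuous_on_compose2[of UNIV _ "{-v..v}" uminus] continuous_intros)
      show "0 < (- 1) ^ J * osc b 0 m (- v)" using J(1) unfolding osc_neg[OF pd(2)] by (simp add: power_add mult_ac)
      show "phase b 0 m (- v) < pi / 2 + (real J + 1) * pi" using J(2) unfolding phase_neg[OF pd(2)]
        by (simp add: algebra_simps)
    qed (use v d osc_sign[OF pd(1)] in auto)
    then obtain A where A: "finite A" "card A = K - J" "\<forall>r\<in>A. osc b 0 m (- r) = 0" by blast
    show ?thesis
      by (rule zeros_real_oscI[of "uminus ` A"]) (use A pd d in \<open>auto simp: card_image\<close>)
  qed
  \<comment> \<open>The first condition puts the target phase above the value (m + 1) pi / 2 at r =
    0, the second puts it below the value at \<open>v0\<close>.\<close>
  have ex: "\<exists>v. 0 \<le> v \<and> phase b 0 m v = pi / 2 + real K * pi \<and> (-1) ^ K * osc b 0 m v > 0"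
    if K: "m \<le> 2 * K" "6 * K + 1 \<le> 4 * m" for K
  proof -
    have "real m \<le> 2 * real K" "6 * real K + 1 \<le> 4 * real m" using K by linarith+
    then have "real m * pi \<le> (2 * real K) * pi" "(6 * real K + 1) * pi \<le> (4 * real m) * pi" 
      by (intro mult_right_mono; simp)+
    then have "phase b 0 m 0 \<le> pi / 2 + real K * pi" "pi / 2 + real K * pi \<le> phase b 0 m v0"
      using v0 unfolding half by (simp_all add: field_simps)
    then obtain v where v: "0 \<le> v" "phase b 0 m v = pi / 2 + real K * pi"
      using IVT_between[of 0 v0 "phase b 0 m" "pi / 2 + real K * pi"] continuous_on_phase[of "{0..v0}" b 0 m] v0(1) pd(2)
      by (metis (mono_tags, lifting) less_imp_le mem_Collect_eq subsetI)
    then show ?thesis using osc_sign[OF pd(1) v(2)] by auto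
  qed
  define n where "n = m div 3"
  consider "m = 3 * n" | "m = 3 * n + 1" "n = 0" | "m = 3 * n + 1" "n > 0" | "m = 3 * n + 2"
    unfolding n_def by linarith
  then show ?thesis
  proof cases
    case 1
    then have m: "real m = 3 * real n" by simp
    have "osc b 0 m v0 > 0" using osc_right_end[OF 1 v0(1) pd(2) v0(2,3)] .
    moreover have "even (m + n)" using 1 by simp
    moreover have "degree (H b 0 m) \<le> n" using degree_H[of b 0 m] by (simp add: n_def)
    ultimately show ?thesis
      using v0 m by (intro concl[of v0 "2 * n" n]) (auto simp: field_simps)
  next
    \<comment> \<open>Here m = 1, and H_1 = -c is the zero polynomial, whose zeros count as
      real.\<close>
    case 2
    then show ?thesis by (simp add: zeros_real_def)
  next
    case 3
    then obtain v where v: "0 \<le> v" "phase b 0 m v = pi / 2 + real (2 * n) * pi" "(-1) ^ (2 * n) * osc b 0 m v > 0"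
      using ex[of "2 * n"] by auto
    have "even (m + (n + 1))" using 3 by simp
    moreover have "degree (H b 0 m) \<le> n - 1" using degree_H_c0[of b n] 3 by simp
    ultimately show ?thesis using v 3 by (intro concl[of v "2 * n" "n + 1"]) (auto simp: algebra_simps)
  next
    case 4
    then obtain v where v: "0 \<le> v" "phase b 0 m v = pi / 2 + real (2 * n + 1) * pi" "(-1) ^ (2 * n + 1) * osc b 0 m v > 0"
      using ex[of "2 * n + 1"] by auto
    have "odd (m + (n + 1))" using 4 by simp
    moreover have "degree (H b 0 m) \<le> n" using degree_H[of b 0 m] by (simp add: n_def)
    ultimately show ?thesis using v 4 by (intro concl[of v "2 * n + 1" "n + 1"]) (auto simp: algebra_simps)
  qed
qed

subsection \<open>Density of the zeros\<close>

lemma nonreal_root_same_arg: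
  assumes r: "disc b c r > 0" "disc b c r' > 0"
    and e: "upper_arg (nonreal_root b c r) = upper_arg (nonreal_root b c r')"
  shows "(c + r) * cmod (nonreal_root b c r') = (c + r') * cmod (nonreal_root b c r)"
proof -
  have Re: "Re (nonreal_root b c x) = cmod (nonreal_root b c x) * cos (upper_arg (nonreal_root b c x))" for x
    by (subst (1) upper_arg_polar[of "nonreal_root b c x", symmetric]) simp
  have "- (c + x) / 2 = cmod (nonreal_root b c x) * cos (upper_arg (nonreal_root b c x))" for x
    using Re[of x] by (simp add: nonreal_root_def)
  then have "c + x = - 2 * cmod (nonreal_root b c x) * cos (upper_arg (nonreal_root b c x))" for x
    by (metis (no_types, opaque_lifting) minus_divide_left minus_equation_iff minus_mult_left mult.assoc nonzero_eq_divide_eq mult.commute zero_neq_numeral)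
  from this[of r] this[of r'] show ?thesis unfolding e by simp
qed

text \<open>Squaring turns the moduli into polynomials in r and r', and the identity obtained is
  divisible by r - r'.\<close>

lemma nonreal_root_same_arg_square:
  assumes "r \<in> pair_dominant b c" "r' \<in> pair_dominant b c" "r \<noteq> r'"
    and "upper_arg (nonreal_root b c r) = upper_arg (nonreal_root b c r')"
  shows "b * ((c + r) + (c + r')) = c * (c + r) * (c + r')"
proof -
  have d: "disc b c r > 0" "disc b c r' > 0" using assms by (auto simp: pair_dominant_def)
  have "(c + r)^2 * (cmod (nonreal_root b c r'))^2 = (c + r')^2 * (cmod (nonreal_root b c r))^2"
    using nonreal_root_same_arg[OF d assms(4)] by (metis power_mult_distrib)
  then have "(c + r)^2 * (r'^2 + (b + c * r')) = (c + r')^2 * (r^2 + (b + c * r))"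
    using d by (simp add: cmod_nonreal_root)
  then have "(r - r') * (b * ((c + r) + (c + r')) - c * (c + r) * (c + r')) = 0"
    by (simp add: algebra_simps power2_eq_square)
  then show ?thesis using assms(3) by simp
qed

text \<open>The squared relation leaves r' = -r; the unsquared one, which still knows the sign, then
  forces r = 0.\<close>

lemma inj_upper_arg_c0:
  assumes "b > 0"
  shows "inj (\<lambda>r. upper_arg (nonreal_root b 0 r))"
proof (rule injI)
  fix r r' assume e: "upper_arg (nonreal_root b 0 r) = upper_arg (nonreal_root b 0 r')"
  have pd: "r \<in> pair_dominant b 0" "disc b 0 r > 0" for r
    using pair_dominant_c0[OF assms] by (auto simp: pair_dominant_def)
  show "r = r'"
  proof (rule ccontr)
    assume ne: "r \<noteq> r'"
    then have "r' = - r" using nonreal_root_same_arg_square[OF pd(1) pd(1) _ e] assms by auto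
    then have "r * (cmod (nonreal_root b 0 r') + cmod (nonreal_root b 0 r)) = 0"
      using nonreal_root_same_arg[OF pd(2) pd(2) e] by (simp add: algebra_simps)
    moreover have "cmod (nonreal_root b 0 r) > 0" using Im_nonreal_root[OF pd(2), of r] by (auto simp: complex_eq_iff)
    ultimately have "r = 0" by (auto simp: add_nonneg_eq_0_iff)
    with \<open>r' = - r\<close> ne show False by simp
  qed
qed

lemma inj_upper_arg_c1:
  assumes "-1 \<le> a" "a \<le> 1/3"
  shows "inj_on (\<lambda>r. upper_arg (nonreal_root a 1 r)) {(2 * sqrt (1 - 3 * a) - 1) / 3<..}"
proof (rule inj_onI)
  fix r r' assume r: "r \<in> {(2 * sqrt (1 - 3 * a) - 1) / 3<..}" "r' \<in> {(2 * sqrt (1 - 3 * a) - 1) / 3<..}"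
    and e: "upper_arg (nonreal_root a 1 r) = upper_arg (nonreal_root a 1 r')"
  define w where "w = sqrt (1 - 3 * a)"
  have "w \<ge> 0" using assms by (simp add: w_def)
  then have pq: "1 + r > 2/3" "1 + r' > 2/3" using r unfolding w_def[symmetric] by auto
  show "r = r'"
  proof (rule ccontr)
    assume "r \<noteq> r'"
    \<comment> \<open>The relation reads a (p + q) = p q. With a \<le> 1/3 it gives 3 p q \<le> p +
      q, while p, q > 2/3 gives 3 p q > 2 p and 3 p q > 2 q, whose sum is a contradiction.\<close>
    define p q P where "p = 1 + r" and "q = 1 + r'" and "P = p * q"
    have "a * (p + q) = P"
      using nonreal_root_same_arg_square[OF pair_dominant_c1[OF assms] pair_dominant_c1[OF assms] _ e] r \<open>r \<noteq> r'\<close>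
      by (simp add: p_def q_def P_def)
    moreover have "a * (p + q) \<le> 1/3 * (p + q)"
      using assms pq by (intro mult_right_mono) (auto simp: p_def q_def)
    moreover have "2/3 * q < P" "p * (2/3) < P"
      using pq unfolding P_def by (intro mult_strict_right_mono mult_strict_left_mono; simp add: p_def q_def)+
    ultimately have "3 * P \<le> p + q" "2 * q < 3 * P" "2 * p < 3 * P" by simp_all
    then show False by linarith
  qed
qed

text \<open>The phase is (m + 2) arg X minus a term in (0, pi), so different arguments at the ends
  make the phase difference exceed 3 pi for large m. This leaves room for two consecutive odd
  multiples of pi/2, where \<open>osc\<close> has opposite signs. \<open>H b c m \<noteq> 0\<close>
  is recorded because \<open>zero_union\<close> leaves out zero polynomials.\<close>

lemma osc_zero_between:
  assumes "s < t" "{s..t} \<subseteq> pair_dominant b c" 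
    and "upper_arg (nonreal_root b c s) \<noteq> upper_arg (nonreal_root b c t)"
  obtains m x where "s \<le> x" "x \<le> t" "osc b c m x = 0" "H b c m \<noteq> 0"
proof -
  have D: "disc b c x > 0" if "x \<in> {s..t}" for x using assms(2) that by (auto simp: pair_dominant_def)
  define d where "d = upper_arg (nonreal_root b c s) - upper_arg (nonreal_root b c t)"
  have "\<bar>d\<bar> > 0" using assms(3) by (simp add: d_def)
  then obtain m where m: "4 * pi < real m * \<bar>d\<bar>" using ex_less_of_nat_mult by blast
  have U: "0 < upper_arg (nonreal_root b c x - of_real x)" "upper_arg (nonreal_root b c x - of_real x) < pi"
      "0 < upper_arg (nonreal_root b c x)" if "x \<in> {s..t}" for x
    using upper_arg_bounds Im_nonreal_root[OF D[OF that]] by auto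
  have diff: "phase b c m s - phase b c m t = real m * d + 2 * d 
      - (upper_arg (nonreal_root b c s - of_real s) - upper_arg (nonreal_root b c t - of_real t))"
    unfolding phase_def d_def by (simp add: algebra_simps)
  have "\<bar>phase b c m s - phase b c m t\<bar> > 3 * pi"
  proof (cases "d > 0")
    case True
    then show ?thesis using m diff U[of s] U[of t] assms(1) by auto
  next
    case False
    then have "\<bar>d\<bar> = - d" by simp
    then have "real m * d < - 4 * pi" using m by simp
    then show ?thesis using diff U[of s] U[of t] assms(1) False by auto
  qed
  have low: "phase b c m x > - pi" if "x \<in> {s..t}" for x
  proof -
    have "(real m + 2) * upper_arg (nonreal_root b c x) > 0" using U(3)[OF that] by simp
    then show ?thesis unfolding phase_def using U(2)[OF that] by linarith
  qed
  define lo where "lo = min (phase b c m s) (phase b c m t)"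
  define hi where "hi = max (phase b c m s) (phase b c m t)"
  have lohi: "lo > - pi" "hi > lo + 3 * pi" 
    using low[of s] low[of t] assms(1) \<open>\<bar>phase b c m s - phase b c m t\<bar> > 3 * pi\<close> unfolding lo_def hi_def by auto
  \<comment> \<open>\<open>nat\<close> cuts off negative values. If it yields k = 0, then hi > lo +
    3 pi > 2 pi still leaves room for the second multiple.\<close>
  define k where "k = nat \<lceil>(lo - pi / 2) / pi\<rceil>"
  have k: "lo \<le> pi / 2 + real k * pi" "pi / 2 + (real k + 1) * pi \<le> hi"
  proof -
    have "(lo - pi / 2) / pi \<le> real k" unfolding k_def by (rule real_nat_ceiling_ge)
    then show "lo \<le> pi / 2 + real k * pi" by (simp add: field_simps)
    show "pi / 2 + (real k + 1) * pi \<le> hi"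
    proof (cases "k = 0")
      case True
      then show ?thesis using lohi pi_gt_zero by (simp del: pi_gt_zero)
    next
      case False
      then have "\<lceil>(lo - pi / 2) / pi\<rceil> > 0" unfolding k_def by simp
      then have "real k < (lo - pi / 2) / pi + 1" unfolding k_def by linarith
      then have "real k * pi < lo + pi / 2" by (simp add: field_simps)
      then show ?thesis using lohi(2) pi_gt_zero unfolding distrib_right by linarith
    qed
  qed
  have cont: "continuous_on {s..t} (phase b c m)" "continuous_on {s..t} (osc b c m)"
    using D by (auto intro!: continuous_on_phase continuous_on_osc)
  have ex: "\<exists>x. s \<le> x \<and> x \<le> t \<and> phase b c m x = y" if "lo \<le> y" "y \<le> hi" for y
  proof -
    have "phase b c m s \<le> y \<and> y \<le> phase b c m t \<or> phase b c m t \<le> y \<and> y \<le> phase b c m s"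
      using that unfolding lo_def hi_def by linarith
    then show ?thesis using IVT_between[OF _ cont(1), of y] assms(1) by (metis less_imp_le)
  qed
  have "real k * pi \<le> (real k + 1) * pi" by (intro mult_right_mono) auto
  then obtain x y where x: "s \<le> x" "x \<le> t" "phase b c m x = pi / 2 + real k * pi"
    and y: "s \<le> y" "y \<le> t" "phase b c m y = pi / 2 + real (Suc k) * pi"
    using ex[of "pi / 2 + real k * pi"] ex[of "pi / 2 + (real k + 1) * pi"] k unfolding of_nat_Suc
    by (smt (verit, ccfv_SIG))
  have gx: "(-1) ^ k * osc b c m x > 0" using osc_sign[OF _ x(3)] assms(2) x by auto
  have gy: "(-1) ^ Suc k * osc b c m y > 0" using osc_sign[OF _ y(3)] assms(2) y by auto
  have "(-1::real) ^ k = 1 \<or> (-1::real) ^ k = - 1" by (simp add: minus_one_power_iff)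
  then have sgn: "osc b c m x > 0 \<and> osc b c m y < 0 \<or> osc b c m x < 0 \<and> osc b c m y > 0" using gx gy by auto
  obtain z where z: "s \<le> z" "z \<le> t" "osc b c m z = 0"
  proof (cases "x \<le> y")
    case True
    have "continuous_on {x..y} (osc b c m)" using cont(2) by (rule continuous_on_subset) (use x y in auto)
    then show ?thesis using IVT_between[of x y "osc b c m" 0] True sgn x y that by (smt (verit))
  next
    case False
    have "continuous_on {y..x} (osc b c m)" using cont(2) by (rule continuous_on_subset) (use x y in auto)
    then show ?thesis using IVT_between[of y x "osc b c m" 0] False sgn x y that by (smt (verit))
  qed
  have "poly (H b c m) (of_real (root_param b c x)) \<noteq> 0"
    using H_zero_iff_osc[OF D] x sgn by auto
  then have "H b c m \<noteq> 0" by auto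
  with z show ?thesis by (rule that)
qed

lemma closure_zero_unionI:
  assumes "open S" "S \<subseteq> pair_dominant b c" "inj_on (\<lambda>r. upper_arg (nonreal_root b c r)) S" "r \<in> S"
  shows "root_param b c r \<in> closure (zero_union b c)"
  unfolding closure_approachable
proof (intro allI impI)
  fix \<epsilon> :: real assume "\<epsilon> > 0"
  have "isCont (root_param b c) r" unfolding root_param_def[abs_def] by (intro continuous_intros)
  then obtain \<delta> where \<delta>: "\<delta> > 0" "\<And>x. dist x r < \<delta> \<Longrightarrow> dist (root_param b c x) (root_param b c r) < \<epsilon>"
    using \<open>\<epsilon> > 0\<close> unfolding continuous_at_eps_delta by (auto simp: dist_real_def)
  obtain \<eta> where \<eta>: "\<eta> > 0" "\<And>x. dist x r < \<eta> \<Longrightarrow> x \<in> S"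
    using assms(1,4) by (metis open_dist)
  define t where "t = r + min \<delta> \<eta> / 2"
  have t: "r < t" "t - r < \<delta>" "t - r < \<eta>" using \<delta>(1) \<eta>(1) unfolding t_def by auto
  have S: "{r..t} \<subseteq> S" using \<eta>(2) t by (auto simp: dist_real_def)
  then have "r \<in> S" "t \<in> S" using t(1) by auto
  then have "upper_arg (nonreal_root b c r) \<noteq> upper_arg (nonreal_root b c t)"
    using inj_onD[OF assms(3), of r t] t(1) by auto
  then obtain m x where x: "r \<le> x" "x \<le> t" "osc b c m x = 0" "H b c m \<noteq> 0"
    using osc_zero_between[OF t(1)] S assms(2) by (metis order_trans)
  have "x \<in> pair_dominant b c" using x S assms(2) by auto
  then have "poly (H b c m) (of_real (root_param b c x)) = 0"
    using H_zero_iff_osc x(3) by (auto simp: pair_dominant_def)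
  then have "root_param b c x \<in> zero_union b c" using x(4) by (auto simp: zero_union_def)
  moreover have "dist x r < \<delta>" using x t by (simp add: dist_real_def)
  ultimately show "\<exists>y\<in>zero_union b c. dist y (root_param b c r) < \<epsilon>" using \<delta>(2) by blast
qed

lemma zero_union_dense_c0:
  assumes "b > 0"
  shows "closure (zero_union b 0) = UNIV"
proof -
  have "x \<in> closure (zero_union b 0)" for x
  proof -
    \<comment> \<open>Chosen so that b y \<ge> |x|: the odd function -(r^3 + b r) then passes x
      between -y and y.\<close>
    define y where "y = 1 + \<bar>x\<bar> / b"
    have e3: "(- y)^3 = - (y^3)" by simp
    have "y \<ge> 0" using assms by (simp add: y_def)
    then have "y^3 \<ge> 0" by simp
    have y3: "b * y = b + \<bar>x\<bar>" "y \<ge> 0"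
      using assms by (simp_all add: field_simps y_def)
    have "root_param b 0 (- y) \<ge> \<bar>x\<bar>" "root_param b 0 y \<le> - \<bar>x\<bar>"
      using assms \<open>y^3 \<ge> 0\<close> y3 unfolding root_param_def e3 by (simp_all, linarith)
    moreover have "continuous_on {- y..y} (root_param b 0)"
      unfolding root_param_def[abs_def] by (intro continuous_intros)
    moreover have "- y \<le> y" using y3 by simp
    ultimately obtain r where "root_param b 0 r = x"
      using IVT_between[of "- y" y "root_param b 0" x] by (smt (verit))
    moreover have "root_param b 0 r \<in> closure (zero_union b 0)"
      using pair_dominant_c0[OF assms] inj_upper_arg_c0[OF assms] by (intro closure_zero_unionI[of UNIV]) auto
    ultimately show ?thesis by simp
  qed
  then show ?thesis by auto
qed

text \<open>The values of \<open>root_param a 1\<close> on r > l cover everything below its value at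
  l, and substituting a = (1 - w^2) / 3 identifies that value with the stated end point. The end
  point itself comes from taking the closure.\<close>

lemma zero_union_dense_c1:
  assumes "-1 \<le> a" "a \<le> 1/3"
  shows "{..(-2 + 9 * a - 2 * sqrt ((1 - 3 * a)^3)) / 27} \<subseteq> closure (zero_union a 1)"
proof -
  define w where "w = sqrt (1 - 3 * a)"
  define l where "l = (2 * w - 1) / 3"
  have w: "w \<ge> 0" "w^2 = 1 - 3 * a" using assms by (auto simp: w_def)
  have w3: "sqrt ((1 - 3 * a)^3) = w^3" by (simp add: w_def real_sqrt_power)
  have a: "a = (1 - w^2) / 3" using w by simp
  have l: "root_param a 1 l = (-2 + 9 * a - 2 * sqrt ((1 - 3 * a)^3)) / 27"
    unfolding w3 unfolding root_param_def l_def a by (simp add: field_simps power2_eq_square power3_eq_cube)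
  have "x \<in> closure (zero_union a 1)" if x: "x < root_param a 1 l" for x
  proof -
    define R where "R = \<bar>l\<bar> + \<bar>x\<bar> + 1"
    have R: "R > l" "R \<ge> 1" "\<bar>x\<bar> \<le> R" by (auto simp: R_def)
    have "\<bar>x\<bar> \<le> R^3 + R^2 + a * R"
    proof -
      have "R * 1 \<le> R * R" using R by (intro mult_left_mono) auto
      moreover have "(R * R) * 1 \<le> (R * R) * R" using R by (intro mult_left_mono) auto
      moreover have "(-1) * R \<le> a * R" using assms R by (intro mult_right_mono) auto
      ultimately have "R * R + R * R * R + a * R \<ge> R" using R by linarith
      then show ?thesis using R by (simp add: power2_eq_square power3_eq_cube)
    qed
    then have "root_param a 1 R \<le> x" by (simp add: root_param_def)
    moreover have "continuous_on {l..R} (root_param a 1)"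
      unfolding root_param_def[abs_def] by (intro continuous_intros)
    ultimately obtain r where r: "root_param a 1 r = x" "l \<le> r"
      using IVT_between[of l R "root_param a 1" x] R x by (metis less_imp_le)
    then have "r > l" using x by (cases "r = l") auto
    then have "root_param a 1 r \<in> closure (zero_union a 1)"
      using pair_dominant_c1[OF assms] inj_upper_arg_c1[OF assms] unfolding l_def w_def
      by (intro closure_zero_unionI[of "{(2 * sqrt (1 - 3 * a) - 1) / 3<..}"]) auto
    then show ?thesis using r by simp
  qed
  then have "closure {..<root_param a 1 l} \<subseteq> closure (zero_union a 1)"
    by (intro closure_minimal) auto
  then show ?thesis unfolding l by simp
qed

section \<open>Transfer from c = 1 to every nonzero c\<close>

lemma zeros_real_scale:
  assumes "c \<noteq> 0"
  shows "zeros_real (H b c m) \<longleftrightarrow> zeros_real (H (b / c^2) 1 m)"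
proof -
  let ?p = "H b c m" and ?q = "H (b / c^2) 1 m"
  have c3: "c^3 \<noteq> 0" using assms by auto
  have pq: "poly ?p z = 0 \<longleftrightarrow> poly ?q (z / of_real (c^3)) = 0" for z
    using H_scale[OF assms, of b m z] assms by simp
  have qp: "poly ?q z = 0 \<longleftrightarrow> poly ?p (z * of_real (c^3)) = 0" for z
    using pq[of "z * of_real (c^3)"] c3 assms by simp
  have "?p = 0 \<longleftrightarrow> ?q = 0"
    unfolding poly_all_0_iff_0[symmetric] using pq qp by metis
  moreover have "(\<forall>z. poly ?p z = 0 \<longrightarrow> Im z = 0) \<longleftrightarrow> (\<forall>z. poly ?q z = 0 \<longrightarrow> Im z = 0)"
  proof -
    have "Im (z / of_real (c^3)) = Im z / c^3" "Im (z * of_real (c^3)) = Im z * c^3" for z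
      by (simp_all only: Im_divide_of_real) simp
    then show ?thesis using pq qp c3 by (metis divide_eq_0_iff mult_eq_0_iff)
  qed
  ultimately show ?thesis unfolding zeros_real_def by simp
qed

lemma zero_union_scale:
  assumes "c \<noteq> 0" "x \<in> zero_union (b / c^2) 1"
  shows "c^3 * x \<in> zero_union b c"
proof -
  obtain m where m: "H (b / c^2) 1 m \<noteq> 0" "poly (H (b / c^2) 1 m) (of_real x) = 0"
    using assms(2) by (auto simp: zero_union_def)
  obtain z where z: "poly (H (b / c^2) 1 m) z \<noteq> 0" using m(1) poly_all_0_iff_0 by blast
  have "poly (H b c m) (z * of_real c ^ 3) \<noteq> 0" 
    using z assms(1) H_scale[OF assms(1), of b m "z * of_real c ^ 3"] by simp
  then have "H b c m \<noteq> 0" by auto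
  moreover have "poly (H b c m) (of_real (c^3 * x)) = 0"
    using m(2) assms(1) H_scale[OF assms(1), of b m "of_real (c^3 * x)"] by simp
  ultimately show ?thesis by (auto simp: zero_union_def)
qed

lemma closure_zero_union_scale:
  assumes "c \<noteq> 0" "x \<in> closure (zero_union (b / c^2) 1)"
  shows "c^3 * x \<in> closure (zero_union b c)"
proof -
  have "(\<lambda>x. c^3 * x) ` closure (zero_union (b / c^2) 1) \<subseteq> closure (zero_union b c)"
    by (rule image_closure_subset)
       (use zero_union_scale[OF assms(1)] closure_subset in \<open>auto intro!: continuous_intros\<close>)
  then show ?thesis using assms(2) by auto
qed

subsection \<open>Non-real zeros\<close>

text \<open>For a real zero t the hypothesis is the claim for the linear factor w - t. The induction
  splits off one zero at a time and multiplies the inequalities; constants give equality.\<close>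

lemma zeros_real_cmod_le:
  assumes "zeros_real p" and t: "\<And>t::real. cmod (w1 - of_real t) * cmod (w3 - of_real t) \<le> (cmod (w2 - of_real t))^2"
  shows "cmod (poly p w1) * cmod (poly p w3) \<le> (cmod (poly p w2))^2"
  using assms(1)
proof (induction "degree p" arbitrary: p)
  case 0
  then obtain a where "p = [:a:]" by (metis degree_eq_zeroE)
  then show ?case by (simp add: power2_eq_square)
next
  case (Suc n)
  then have "\<not> constant (poly p)" by (simp add: constant_degree)
  then obtain z where z: "poly p z = 0" using fundamental_theorem_of_algebra by blast
  have "p \<noteq> 0" using Suc by auto
  then have "Im z = 0" using Suc z by (auto simp: zeros_real_def)
  then obtain x where x: "z = of_real x" using complex_is_Real_iff Reals_cases by metis
  obtain q where q: "p = [:- z, 1:] * q" using z by (metis poly_eq_0_iff_dvd dvdE)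
  then have "q \<noteq> 0" using \<open>p \<noteq> 0\<close> by auto
  then have "n = degree q" using Suc.hyps(2) unfolding q by (subst (asm) degree_mult_eq) auto
  moreover have "zeros_real q" using Suc.prems \<open>p \<noteq> 0\<close> unfolding zeros_real_def q by auto
  ultimately have IH: "cmod (poly q w1) * cmod (poly q w3) \<le> (cmod (poly q w2))^2" by (rule Suc.hyps(1))
  have P: "cmod (poly p w) = cmod (w - of_real x) * cmod (poly q w)" for w
    unfolding q x by (simp add: norm_mult flip: norm_mult) (simp add: algebra_simps)
  have "(cmod (w1 - of_real x) * cmod (w3 - of_real x)) * (cmod (poly q w1) * cmod (poly q w3))
      \<le> (cmod (w2 - of_real x))^2 * (cmod (poly q w2))^2"
    using IH t by (intro mult_mono) auto
  then show ?case unfolding P by (simp add: power_mult_distrib mult_ac)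
qed

section \<open>Growth of H_m(z) in m at a fixed z with three distinct roots\<close>

definition cubic_roots :: "real \<Rightarrow> real \<Rightarrow> complex \<Rightarrow> complex \<Rightarrow> complex \<Rightarrow> complex \<Rightarrow> bool" where
  "cubic_roots b c z p q s \<longleftrightarrow> p \<noteq> q \<and> q \<noteq> s \<and> p \<noteq> s \<and>
     (\<forall>x\<in>{p, q, s}. x^3 + of_real c * x^2 + of_real b * x + z = 0)"

lemma cubic_roots_vieta:
  assumes "cubic_roots b c z p q s"
  shows "p + q + s = - of_real c" "p * q + q * s + p * s = of_real b" "p * q * s = - z"
proof -
  let ?c = "complex_of_real c" and ?b = "complex_of_real b"
  have e: "p^3 + ?c * p^2 + ?b * p + z = 0" "q^3 + ?c * q^2 + ?b * q + z = 0" "s^3 + ?c * s^2 + ?b * s + z = 0"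
    and d: "p - q \<noteq> 0" "q - s \<noteq> 0" "p - s \<noteq> 0"
    using assms by (auto simp: cubic_roots_def)
  have "(p - q) * (p^2 + p * q + q^2 + ?c * (p + q) + ?b) = (p^3 + ?c * p^2 + ?b * p + z) - (q^3 + ?c * q^2 + ?b * q + z)"
    by (simp add: algebra_simps power2_eq_square power3_eq_cube)
  then have 1: "p^2 + p * q + q^2 + ?c * (p + q) + ?b = 0" using e d by simp
  have "(p - s) * (p^2 + p * s + s^2 + ?c * (p + s) + ?b) = (p^3 + ?c * p^2 + ?b * p + z) - (s^3 + ?c * s^2 + ?b * s + z)"
    by (simp add: algebra_simps power2_eq_square power3_eq_cube)
  then have 2: "p^2 + p * s + s^2 + ?c * (p + s) + ?b = 0" using e d by simp
  have "(q - s) * (p + q + s + ?c) = (p^2 + p * q + q^2 + ?c * (p + q) + ?b) - (p^2 + p * s + s^2 + ?c * (p + s) + ?b)"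
    by (simp add: algebra_simps power2_eq_square)
  then have s0: "p + q + s + ?c = 0" using 1 2 d by simp
  then have c: "?c = - (p + q + s)" by (simp add: add_eq_0_iff)
  then show "p + q + s = - ?c" by simp
  have "p * q + q * s + p * s - ?b = - (p^2 + p * q + q^2 + ?c * (p + q) + ?b)"
    unfolding c by (simp add: algebra_simps power2_eq_square)
  then show b: "p * q + q * s + p * s = ?b" unfolding 1 by simp
  have "p * q * s + z = p^3 + ?c * p^2 + ?b * p + z"
    unfolding c b[symmetric] by (simp add: algebra_simps power2_eq_square power3_eq_cube)
  then show "p * q * s = - z" unfolding e(1) by (simp add: eq_neg_iff_add_eq_0)
qed

text \<open>After division by p^m only the term of p in the Vandermonde formula survives, and its
  limit p^2 (q - s) is nonzero.\<close>

lemma H_lower_bound: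
  assumes "cubic_roots b c z p q s" "cmod q < cmod p" "cmod s < cmod p"
  obtains \<kappa> where "\<kappa> > 0" "\<forall>\<^sub>F m in sequentially. \<kappa> * cmod p ^ m \<le> cmod (poly (H b c m) z)"
proof -
  let ?V = "(p - q) * (q - s) * (p - s)"
  have d: "p \<noteq> q" "q \<noteq> s" "p \<noteq> s" and p: "p \<noteq> 0" using assms by (auto simp: cubic_roots_def)
  have "cmod (q / p) < 1" "cmod (s / p) < 1" using assms(2,3) p by (simp_all add: norm_divide)
  then have "(\<lambda>m. (q / p) ^ m) \<longlonglongrightarrow> 0" "(\<lambda>m. (s / p) ^ m) \<longlonglongrightarrow> 0"
    by (intro LIMSEQ_power_zero; simp)+
  then have "(\<lambda>m. p^2 * (q - s) - (q / p) ^ m * (q^2 * (p - s)) + (s / p) ^ m * (s^2 * (p - q)))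
      \<longlonglongrightarrow> p^2 * (q - s) - 0 * (q^2 * (p - s)) + 0 * (s^2 * (p - q))"
    by (intro tendsto_add tendsto_diff tendsto_mult tendsto_const)
  moreover have "p^2 * (q - s) - (q / p) ^ m * (q^2 * (p - s)) + (s / p) ^ m * (s^2 * (p - q))
      = poly (H b c m) z * ?V / p ^ m" for m
    unfolding H_vandermonde[OF cubic_roots_vieta[OF assms(1)]] using p
    by (simp add: field_simps power_add power2_eq_square)
  ultimately have "(\<lambda>m. cmod (poly (H b c m) z * ?V / p ^ m)) \<longlonglongrightarrow> cmod (p^2 * (q - s))"
    by (simp add: tendsto_norm)
  moreover have "cmod (p^2 * (q - s)) / 2 < cmod (p^2 * (q - s))" using p d by simp
  ultimately have ev: "\<forall>\<^sub>F m in sequentially. cmod (p^2 * (q - s)) / 2 < cmod (poly (H b c m) z * ?V / p ^ m)"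
    by (rule order_tendstoD)
  define v where "v = cmod ?V"
  define N where "N = cmod (p^2 * (q - s)) / 2"
  have vN: "v > 0" "N > 0" using d p by (auto simp: v_def N_def)
  have "\<forall>\<^sub>F m in sequentially. N / v * cmod p ^ m \<le> cmod (poly (H b c m) z)"
    using ev
  proof eventually_elim
    case (elim m)
    then have "N < cmod (poly (H b c m) z) * v / cmod p ^ m"
      unfolding N_def v_def norm_divide norm_mult norm_power .
    then show ?case using vN(1) p by (simp add: field_simps)
  qed
  moreover have "N / v > 0" using vN by simp
  ultimately show ?thesis using that by blast
qed

lemma H_upper_bound:
  assumes "cubic_roots b c z p q s" "cmod p \<le> M" "cmod q \<le> M" "cmod s \<le> M"
  obtains C where "C > 0" "\<And>m. cmod (poly (H b c m) z) \<le> C * M ^ m"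
proof -
  let ?V = "(p - q) * (q - s) * (p - s)"
  have V: "cmod ?V > 0" using assms by (auto simp: cubic_roots_def)
  define D where "D = cmod (q - s) + cmod (p - s) + cmod (p - q)"
  have M: "M \<ge> 0" using assms(2) norm_ge_zero order_trans by blast
  have "cmod (poly (H b c m) z) \<le> (D * M^2 / cmod ?V + 1) * M ^ m" for m
  proof -
    have "cmod (poly (H b c m) z) * cmod ?V = cmod (p ^ (m + 2) * (q - s) - q ^ (m + 2) * (p - s) + s ^ (m + 2) * (p - q))"
      unfolding H_vandermonde[OF cubic_roots_vieta[OF assms(1)], symmetric] norm_mult by simp
    also have "\<dots> \<le> cmod (p ^ (m + 2) * (q - s)) + cmod (q ^ (m + 2) * (p - s)) + cmod (s ^ (m + 2) * (p - q))"
      by (meson add_mono_thms_linordered_semiring(3) norm_triangle_ineq norm_triangle_ineq4 order_trans)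
    also have "\<dots> \<le> M ^ (m + 2) * cmod (q - s) + M ^ (m + 2) * cmod (p - s) + M ^ (m + 2) * cmod (p - q)"
      unfolding norm_mult norm_power using assms by (intro add_mono mult_right_mono power_mono) auto
    also have "\<dots> = D * M^2 * M ^ m" by (simp add: D_def algebra_simps power_add power2_eq_square)
    finally have "cmod (poly (H b c m) z) \<le> D * M^2 / cmod ?V * M ^ m"
      using V by (simp add: field_simps)
    also have "\<dots> \<le> (D * M^2 / cmod ?V + 1) * M ^ m" using M by (intro mult_right_mono) auto
    finally show ?thesis .
  qed
  moreover have "D * M^2 / cmod ?V + 1 > 0" unfolding D_def by (intro add_nonneg_pos) auto
  ultimately show ?thesis using that by blast
qed

text \<open>If all zeros were real, the product at z1 and z3, which grows at least like (|p1|
  |p3|)^m, would be bounded by the square at z2, which grows at most like M^(2 m) for the largest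
  modulus M there; but M^2 < |p1| |p3|.\<close>

lemma not_zeros_realI:
  assumes r1: "cubic_roots b c z1 p1 q1 s1" "cmod q1 < cmod p1" "cmod s1 < cmod p1"
    and r2: "cubic_roots b c z2 p2 q2 s2" 
    and r3: "cubic_roots b c z3 p3 q3 s3" "cmod q3 < cmod p3" "cmod s3 < cmod p3"
    and less: "(cmod p2)^2 < cmod p1 * cmod p3" "(cmod q2)^2 < cmod p1 * cmod p3" "(cmod s2)^2 < cmod p1 * cmod p3"
    and t: "\<And>t::real. cmod (z1 - of_real t) * cmod (z3 - of_real t) \<le> (cmod (z2 - of_real t))^2"
  shows "\<not> (\<forall>m. zeros_real (H b c m))"
proof
  assume real: "\<forall>m. zeros_real (H b c m)"
  define M where "M = Max {cmod p2, cmod q2, cmod s2}"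
  have M: "cmod p2 \<le> M" "cmod q2 \<le> M" "cmod s2 \<le> M" by (auto simp: M_def)
  have "M \<in> {cmod p2, cmod q2, cmod s2}" unfolding M_def by (intro Max_in) auto
  then have M2: "M^2 < cmod p1 * cmod p3" "M \<ge> 0" using less by auto
  define \<rho> where "\<rho> = cmod p1 * cmod p3"
  have \<rho>: "\<rho> > 0" "M^2 < \<rho>" using M2 unfolding \<rho>_def by (auto intro: le_less_trans[OF zero_le_power2])
  obtain \<kappa>1 where \<kappa>1: "\<kappa>1 > 0" "\<forall>\<^sub>F m in sequentially. \<kappa>1 * cmod p1 ^ m \<le> cmod (poly (H b c m) z1)"
    by (rule H_lower_bound[OF r1])
  obtain \<kappa>3 where \<kappa>3: "\<kappa>3 > 0" "\<forall>\<^sub>F m in sequentially. \<kappa>3 * cmod p3 ^ m \<le> cmod (poly (H b c m) z3)"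
    by (rule H_lower_bound[OF r3])
  obtain C where C: "C > 0" "\<And>m. cmod (poly (H b c m) z2) \<le> C * M ^ m"
    by (rule H_upper_bound[OF r2 M]) blast
  have "(\<lambda>m. (M^2 / \<rho>) ^ m) \<longlonglongrightarrow> 0" using \<rho> by (intro LIMSEQ_power_zero) simp
  moreover have "0 < \<kappa>1 * \<kappa>3 / C^2" using \<kappa>1 \<kappa>3 C by simp
  ultimately have "\<forall>\<^sub>F m in sequentially. (M^2 / \<rho>) ^ m < \<kappa>1 * \<kappa>3 / C^2" by (rule order_tendstoD)
  with \<kappa>1(2) \<kappa>3(2) have "\<forall>\<^sub>F m::nat in sequentially. False"
  proof eventually_elim
    case (elim m)
    have "(\<kappa>1 * cmod p1 ^ m) * (\<kappa>3 * cmod p3 ^ m) \<le> cmod (poly (H b c m) z1) * cmod (poly (H b c m) z3)"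
      using elim \<kappa>3 by (intro mult_mono) auto
    also have "\<dots> \<le> (cmod (poly (H b c m) z2))^2" using real by (intro zeros_real_cmod_le t) auto
    also have "\<dots> \<le> (C * M ^ m)^2" using C by (intro power_mono) auto
    finally have "\<kappa>1 * \<kappa>3 * \<rho> ^ m \<le> C^2 * (M^2) ^ m" unfolding \<rho>_def
      by (simp add: power_mult_distrib mult_ac flip: power_mult)
    moreover have "C^2 * (M^2) ^ m < \<kappa>1 * \<kappa>3 * \<rho> ^ m" 
      using elim(3) \<rho>(1) C(1) by (simp add: power_divide field_simps)
    ultimately show False by simp
  qed
  then show False by simp
qed

section \<open>Moduli of the roots to first order, and the two crossing points\<close>

lemma cubic_root_branch:
  fixes b c :: real and x0 :: complex
  defines "F \<equiv> \<lambda>x. - (x^3 + of_real c * x^2 + of_real b * x)"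
    and "d \<equiv> 3 * x0^2 + 2 * of_real c * x0 + of_real b"
  assumes "d \<noteq> 0"
  obtains g where "g (F x0) = x0" "(g has_field_derivative - inverse d) (at (F x0))"
    "\<forall>\<^sub>F z in nhds (F x0). F (g z) = z"
proof -
  have hol: "F holomorphic_on UNIV" unfolding F_def by (intro holomorphic_intros)
  have der: "(F has_field_derivative - d) (at x0)"
    unfolding F_def d_def by (auto intro!: derivative_eq_intros simp: algebra_simps)
  then have "deriv F x0 \<noteq> 0" using assms(3) DERIV_imp_deriv by fastforce
  then obtain r where r: "r > 0" "open (F ` ball x0 r)" "inj_on F (ball x0 r)"
    using has_complex_derivative_locally_invertible[OF hol UNIV_I open_UNIV] by metis
  define g where "g = inv_into (ball x0 r) F"
  have gF: "g (F x) = x" if "x \<in> ball x0 r" for x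
    unfolding g_def using r(3) that by (rule inv_into_f_f)
  have x0: "x0 \<in> ball x0 r" using r(1) by simp
  show ?thesis
  proof (rule that[of g])
    show "g (F x0) = x0" using gF[OF x0] .
    have "(g has_field_derivative inverse (- d)) (at (F x0))"
      by (rule has_field_derivative_inverse_strong[OF der _ open_ball x0])
         (use assms(3) gF hol in \<open>auto intro: holomorphic_on_imp_continuous_on holomorphic_on_subset\<close>)
    then show "(g has_field_derivative - inverse d) (at (F x0))" by simp
    have "F (g z) = z" if "z \<in> F ` ball x0 r" for z
      unfolding g_def using that by (rule f_inv_into_f)
    then show "\<forall>\<^sub>F z in nhds (F x0). F (g z) = z"
      by (intro eventually_mono[OF eventually_nhds_in_open[OF r(2) imageI[OF x0]]])
  qed
qed

lemma ln_cmod_has_derivative: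
  fixes g :: "complex \<Rightarrow> complex"
  assumes "(g has_field_derivative g') (at z)" "g z \<noteq> 0"
  shows "((\<lambda>e. ln (cmod (g (z + of_real e * w)))) has_real_derivative Re (g' / g z * w)) (at 0)"
proof -
  define h where "h e = g (z + of_real e * w)" for e
  have "((\<lambda>e. z + of_real e * w) has_vector_derivative w) (at 0)"
    by (auto intro!: derivative_eq_intros simp: has_vector_derivative_def scaleR_conv_of_real)
  then have h: "(h has_vector_derivative w * g') (at 0)"
    using field_vector_diff_chain_at[of "\<lambda>e. z + of_real e * w" w 0 g g'] assms(1)
    unfolding h_def[abs_def] by (simp add: o_def)
  have h0: "h 0 = g z" by (simp add: h_def)
  have Re: "((\<lambda>e. Re (h e)) has_real_derivative Re (w * g')) (at 0)" 
    and Im: "((\<lambda>e. Im (h e)) has_real_derivative Im (w * g')) (at 0)"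
    using h by (auto simp: has_real_derivative_iff_has_vector_derivative has_vector_derivative_complex_iff)
  have pos: "(Re (h 0))^2 + (Im (h 0))^2 > 0" using assms(2) unfolding h0
    by (simp add: complex_neq_0)
  \<comment> \<open>Writing ln |h| as ln (Re^2 + Im^2) / 2 brings it within reach of the derivative
    rules; the two agree for every e, also where h vanishes, because \<open>ln 0\<close> is
    0.\<close>
  have "((\<lambda>e. ln ((Re (h e))^2 + (Im (h e))^2) / 2) has_real_derivative
      (2 * Re (h 0) * Re (w * g') + 2 * Im (h 0) * Im (w * g')) / ((Re (h 0))^2 + (Im (h 0))^2) / 2) (at 0)"
    by (rule Re Im pos refl derivative_eq_intros)+ (use pos in \<open>simp_all add: field_simps\<close>)
  moreover have "ln ((Re (h e))^2 + (Im (h e))^2) / 2 = ln (cmod (h e))" for e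
  proof -
    have "(Re (h e))^2 + (Im (h e))^2 = (cmod (h e))^2" by (simp add: cmod_power2)
    then show ?thesis by (cases "h e = 0") (auto simp: ln_realpow)
  qed
  moreover have "(2 * Re (h 0) * Re (w * g') + 2 * Im (h 0) * Im (w * g')) / ((Re (h 0))^2 + (Im (h 0))^2) / 2
      = Re (g' / g z * w)"
  proof -
    have "Re (g' / g z * w) = Re (w * g' / g z)" by (simp add: mult.commute)
    also have "\<dots> = (Re (w * g') * Re (g z) + Im (w * g') * Im (g z)) / ((Re (g z))^2 + (Im (g z))^2)"
      by (rule Re_divide)
    finally have "Re (g' / g z * w) = \<dots>" .
    moreover have "(2 * R * A + 2 * I * B) / S / 2 = (A * R + B * I) / S" for R A I B S :: real
    proof -
      have "2 * R * A + 2 * I * B = (A * R + B * I) * 2" by (simp add: algebra_simps)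
      moreover have "x * 2 / S / 2 = x / S" for x :: real by simp
      ultimately show ?thesis by (simp only:)
    qed
    ultimately show ?thesis unfolding h0 by (simp only:)
  qed
  ultimately show ?thesis unfolding h_def by simp
qed

lemma eventually_less_at_right:
  fixes f g :: "real \<Rightarrow> real"
  assumes f: "(f has_real_derivative f') (at 0)" and g: "(g has_real_derivative g') (at 0)"
    and "f 0 < g 0 \<or> f 0 = g 0 \<and> f' < g'"
  shows "\<forall>\<^sub>F e in at_right 0. f e < g e"
proof (cases "f 0 < g 0")
  case True
  have d: "((\<lambda>e. g e - f e) has_real_derivative g' - f') (at 0)" using f g by (intro derivative_intros)
  then have "isCont (\<lambda>e. g e - f e) 0" by (rule DERIV_isCont)
  then have "\<forall>\<^sub>F e in at 0. g e - f e > 0" unfolding isCont_def using True by (intro order_tendstoD) auto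
  then show ?thesis unfolding eventually_at_split by (auto elim: eventually_mono)
next
  case False
  have d: "((\<lambda>e. g e - f e) has_real_derivative g' - f') (at 0)" using f g by (intro derivative_intros)
  obtain \<delta> where "\<delta> > 0" "\<And>h. 0 < h \<Longrightarrow> h < \<delta> \<Longrightarrow> g 0 - f 0 < g (0 + h) - f (0 + h)"
    using DERIV_pos_inc_right[OF d] False assms(3) by auto
  then show ?thesis using False assms(3) unfolding eventually_at_right_field by (intro exI[of _ \<delta>]) auto
qed

text \<open>
  u x is the logarithmic derivative in z of the root through x, so at z0 + e W its modulus is
  \<rho> (1 + e Re (u x W) + o(e)) for e > 0 small.
\<close>

lemma not_zeros_real_crossing:
  fixes b c z0 :: real and x1 x2 x3 W1 W2 W3 :: complex
  defines "u \<equiv> \<lambda>x. - inverse (3 * x^2 + 2 * of_real c * x + of_real b) / x"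
  assumes roots: "cubic_roots b c (of_real z0) x1 x2 x3"
    and mods: "cmod x1 = \<rho>" "cmod x2 = \<rho>" "cmod x3 \<le> \<rho>" "x3 \<noteq> 0"
    and W1: "Re (u x2 * W1) < Re (u x1 * W1)" "cmod x3 = \<rho> \<Longrightarrow> Re (u x3 * W1) < Re (u x1 * W1)"
    and W3: "Re (u x1 * W3) < Re (u x2 * W3)" "cmod x3 = \<rho> \<Longrightarrow> Re (u x3 * W3) < Re (u x2 * W3)"
    and W2: "2 * Re (u x1 * W2) < Re (u x1 * W1) + Re (u x2 * W3)"
      "2 * Re (u x2 * W2) < Re (u x1 * W1) + Re (u x2 * W3)"
      "cmod x3 = \<rho> \<Longrightarrow> 2 * Re (u x3 * W2) < Re (u x1 * W1) + Re (u x2 * W3)"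
    and t: "\<And>t::real. cmod (W1 - of_real t) * cmod (W3 - of_real t) \<le> (cmod (W2 - of_real t))^2"
  shows "\<not> (\<forall>m. zeros_real (H b c m))"
proof -
  note vieta = cubic_roots_vieta[OF roots]
  define F where "F x = - (x^3 + of_real c * x^2 + of_real b * x)" for x :: complex
  define d where "d x = 3 * x^2 + 2 * of_real c * x + of_real b" for x :: complex
  have Fz: "F x = z \<longleftrightarrow> x^3 + of_real c * x^2 + of_real b * x + z = 0" for x z
    unfolding F_def by (metis add.right_inverse minus_unique)
  have dist: "x1 \<noteq> x2" "x2 \<noteq> x3" "x1 \<noteq> x3" and F: "F x1 = z0" "F x2 = z0" "F x3 = z0"
    using roots unfolding cubic_roots_def Fz by auto
  have cc: "complex_of_real c = - (x1 + x2 + x3)" using vieta(1) by simp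
  have "d x1 = (x1 - x2) * (x1 - x3)" "d x2 = (x2 - x1) * (x2 - x3)" "d x3 = (x3 - x1) * (x3 - x2)"
    unfolding d_def vieta(2)[symmetric] cc by (simp_all add: algebra_simps power2_eq_square)
  then have d: "d x1 \<noteq> 0" "d x2 \<noteq> 0" "d x3 \<noteq> 0" using dist by auto
  have ex: "\<exists>g. g z0 = x \<and> (g has_field_derivative - inverse (d x)) (at z0) \<and> (\<forall>\<^sub>F z in nhds (complex_of_real z0). F (g z) = z)"
    if "d x \<noteq> 0" "F x = z0" for x
    by (rule cubic_root_branch[where c = c and b = b and ?x0.0 = x, folded F_def d_def]) (use that in auto)
  obtain g1 where g1: "g1 z0 = x1" "(g1 has_field_derivative - inverse (d x1)) (at z0)" 
      "\<forall>\<^sub>F z in nhds (complex_of_real z0). F (g1 z) = z"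
    using ex[OF d(1) F(1)] by blast
  obtain g2 where g2: "g2 z0 = x2" "(g2 has_field_derivative - inverse (d x2)) (at z0)" 
      "\<forall>\<^sub>F z in nhds (complex_of_real z0). F (g2 z) = z"
    using ex[OF d(2) F(2)] by blast
  obtain g3 where g3: "g3 z0 = x3" "(g3 has_field_derivative - inverse (d x3)) (at z0)" 
      "\<forall>\<^sub>F z in nhds (complex_of_real z0). F (g3 z) = z"
    using ex[OF d(3) F(3)] by blast
  have cont: "isCont g1 z0" "isCont g2 z0" "isCont g3 z0"
    using g1(2) g2(2) g3(2) DERIV_isCont by blast+
  have nz: "x1 \<noteq> 0" "x2 \<noteq> 0" "x3 \<noteq> 0" "\<rho> > 0" using mods dist by auto
  define L where "L g W e = ln (cmod (g (of_real z0 + of_real e * W)))" for g :: "complex \<Rightarrow> complex" and W and e :: real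
  have u: "u x = - inverse (d x) / x" for x unfolding u_def d_def ..
  have L1: "(L g1 W has_real_derivative Re (u x1 * W)) (at 0)" and
    L2: "(L g2 W has_real_derivative Re (u x2 * W)) (at 0)" and
    L3: "(L g3 W has_real_derivative Re (u x3 * W)) (at 0)" for W
    using ln_cmod_has_derivative[OF g1(2), of W] ln_cmod_has_derivative[OF g2(2), of W] 
      ln_cmod_has_derivative[OF g3(2), of W] nz unfolding L_def[abs_def] u g1(1) g2(1) g3(1) by auto
  have L0: "L g1 W 0 = ln \<rho>" "L g2 W 0 = ln \<rho>" "L g3 W 0 = ln (cmod x3)" for W
    using mods g1(1) g2(1) g3(1) by (auto simp: L_def)
  \<comment> \<open>If |x3| < \<rho>, every comparison with x3 is already strict at e = 0; only |x3|
    = \<rho> calls for the derivative conditions.\<close>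
  have l3: "cmod x3 = \<rho> \<or> ln (cmod x3) < ln \<rho>" using mods nz by auto
  have good: "\<forall>\<^sub>F z in nhds (of_real z0). cubic_roots b c z (g1 z) (g2 z) (g3 z) \<and> g1 z \<noteq> 0 \<and> g2 z \<noteq> 0 \<and> g3 z \<noteq> 0"
  proof -
    have ne: "\<forall>\<^sub>F z in nhds (of_real z0). f z \<noteq> h z" if "isCont f z0" "isCont h z0" "f z0 \<noteq> h z0" for f h :: "complex \<Rightarrow> complex"
    proof -
      have "isCont (\<lambda>z. f z - h z) z0" using that by (intro continuous_intros)
      then have "((\<lambda>z. f z - h z) \<longlongrightarrow> f z0 - h z0) (nhds (complex_of_real z0))"
        unfolding isCont_def tendsto_at_iff_tendsto_nhds[where g = "\<lambda>z. f z - h z"] .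
      then have "\<forall>\<^sub>F z in nhds (of_real z0). f z - h z \<noteq> 0" using that(3) by (intro tendsto_imp_eventually_ne) auto
      then show ?thesis by (rule eventually_mono) auto
    qed
    have "\<forall>\<^sub>F z in nhds (of_real z0). g1 z \<noteq> g2 z" "\<forall>\<^sub>F z in nhds (of_real z0). g2 z \<noteq> g3 z" 
      "\<forall>\<^sub>F z in nhds (of_real z0). g1 z \<noteq> g3 z" "\<forall>\<^sub>F z in nhds (of_real z0). g1 z \<noteq> 0" 
      "\<forall>\<^sub>F z in nhds (of_real z0). g2 z \<noteq> 0" "\<forall>\<^sub>F z in nhds (of_real z0). g3 z \<noteq> 0"
      using cont dist nz g1(1) g2(1) g3(1) by (intro ne; simp)+
    with g1(3) g2(3) g3(3) show ?thesis
    proof eventually_elim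
      case (elim z)
      then show ?case unfolding cubic_roots_def Fz by auto
    qed
  qed
  have good_at: "\<forall>\<^sub>F e in at_right 0. cubic_roots b c (of_real z0 + of_real e * W) (g1 (of_real z0 + of_real e * W))
      (g2 (of_real z0 + of_real e * W)) (g3 (of_real z0 + of_real e * W)) \<and> g1 (of_real z0 + of_real e * W) \<noteq> 0
      \<and> g2 (of_real z0 + of_real e * W) \<noteq> 0 \<and> g3 (of_real z0 + of_real e * W) \<noteq> 0" for W
  proof -
    have "((\<lambda>e. of_real z0 + of_real e * W) \<longlongrightarrow> of_real z0 + of_real 0 * W) (at_right 0)"
      by (intro tendsto_intros)
    then have "filterlim (\<lambda>e. of_real z0 + of_real e * W) (nhds (of_real z0)) (at_right 0)" by simp
    then show ?thesis using good by (rule eventually_compose_filterlim[rotated])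
  qed
  have "\<forall>\<^sub>F e in at_right 0. L g2 W1 e < L g1 W1 e"
    by (rule eventually_less_at_right[OF L2 L1]) (use L0 W1 in auto)
  moreover have "\<forall>\<^sub>F e in at_right 0. L g3 W1 e < L g1 W1 e"
    by (rule eventually_less_at_right[OF L3 L1]) (use L0 W1 l3 in auto)
  moreover have "\<forall>\<^sub>F e in at_right 0. L g1 W3 e < L g2 W3 e"
    by (rule eventually_less_at_right[OF L1 L2]) (use L0 W3 in auto)
  moreover have "\<forall>\<^sub>F e in at_right 0. L g3 W3 e < L g2 W3 e"
    by (rule eventually_less_at_right[OF L3 L2]) (use L0 W3 l3 in auto)
  moreover have "\<forall>\<^sub>F e in at_right 0. 2 * L g1 W2 e < L g1 W1 e + L g2 W3 e"
    by (rule eventually_less_at_right[OF DERIV_cmult[OF L1] DERIV_add[OF L1 L2]]) (use L0 W2 in auto)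
  moreover have "\<forall>\<^sub>F e in at_right 0. 2 * L g2 W2 e < L g1 W1 e + L g2 W3 e"
    by (rule eventually_less_at_right[OF DERIV_cmult[OF L2] DERIV_add[OF L1 L2]]) (use L0 W2 in auto)
  moreover have "\<forall>\<^sub>F e in at_right 0. 2 * L g3 W2 e < L g1 W1 e + L g2 W3 e"
    by (rule eventually_less_at_right[OF DERIV_cmult[OF L3] DERIV_add[OF L1 L2]]) (use L0 W2 l3 in auto)
  moreover have "\<forall>\<^sub>F e in at_right 0. (e::real) > 0" by (rule eventually_at_right_less)
  ultimately have "\<forall>\<^sub>F e::real in at_right 0. \<not> (\<forall>m. zeros_real (H b c m))"
    using good_at[of W1] good_at[of W2] good_at[of W3]
  proof eventually_elim
    case (elim e)
    let ?z = "\<lambda>W. of_real z0 + of_real e * W"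
    have sq: "(cmod x)^2 < cmod y * cmod y'" if "x \<noteq> 0" "y \<noteq> 0" "y' \<noteq> 0" "2 * ln (cmod x) < ln (cmod y) + ln (cmod y')" for x y y' :: complex
    proof -
      have "ln ((cmod x)^2) < ln (cmod y * cmod y')" using that by (simp add: ln_mult ln_realpow)
      then show ?thesis using that by (subst (asm) ln_less_cancel_iff) auto
    qed
    \<comment> \<open>The condition on W1, W2, W3 ranges over all real t, so it survives a real
      shift by z0 and scaling by e > 0, with t replaced by (t - z0) / e.\<close>
    have scale: "?z W - of_real t = of_real e * (W - of_real ((t - z0) / e))" for W :: complex and t
    proof -
      have "complex_of_real e * of_real ((t - z0) / e) = of_real (t - z0)"
        using elim(8) unfolding of_real_mult[symmetric] by simp
      then show ?thesis by (simp add: right_diff_distrib)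
    qed
    show ?case
    proof (rule not_zeros_realI)
      show "cubic_roots b c (?z W1) (g1 (?z W1)) (g2 (?z W1)) (g3 (?z W1))"
        "cubic_roots b c (?z W2) (g1 (?z W2)) (g2 (?z W2)) (g3 (?z W2))" using elim(9,10) by blast+
      show "cubic_roots b c (?z W3) (g2 (?z W3)) (g1 (?z W3)) (g3 (?z W3))" using elim(11)
        unfolding cubic_roots_def by auto
      show "cmod (g2 (?z W1)) < cmod (g1 (?z W1))" "cmod (g3 (?z W1)) < cmod (g1 (?z W1))"
        "cmod (g1 (?z W3)) < cmod (g2 (?z W3))" "cmod (g3 (?z W3)) < cmod (g2 (?z W3))"
        using elim(1-4,9,11) unfolding L_def by simp_all
      show "(cmod (g1 (?z W2)))^2 < cmod (g1 (?z W1)) * cmod (g2 (?z W3))"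
        "(cmod (g2 (?z W2)))^2 < cmod (g1 (?z W1)) * cmod (g2 (?z W3))"
        "(cmod (g3 (?z W2)))^2 < cmod (g1 (?z W1)) * cmod (g2 (?z W3))"
        using elim(5-7,9-11) unfolding L_def by (intro sq; simp)+
      show "cmod (?z W1 - of_real t) * cmod (?z W3 - of_real t) \<le> (cmod (?z W2 - of_real t))^2" for t
      proof -
        have "cmod (?z W1 - of_real t) * cmod (?z W3 - of_real t) = e^2 *
          (cmod (W1 - of_real ((t - z0) / e)) * cmod (W3 - of_real ((t - z0) / e)))"
          unfolding scale norm_mult by (simp add: power2_eq_square)
        also have "\<dots> \<le> e^2 * (cmod (W2 - of_real ((t - z0) / e)))^2"
          by (intro mult_left_mono assms) auto
        also have "\<dots> = (cmod (?z W2 - of_real t))^2" 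
          unfolding scale norm_mult by (simp add: power_mult_distrib)
        finally show ?thesis .
      qed
    qed
  qed
  then show ?thesis by simp
qed

text \<open>At z = a the cubic is (x + 1) (x^2 + a), with roots s and -s of modulus s > 1 and the
  smaller root -1. Moving z to the right favours -s, to the left s, while in the direction \<i>
  neither modulus changes to first order.\<close>

lemma not_zeros_real_below:
  assumes "a < -1"
  shows "\<not> (\<forall>m. zeros_real (H a 1 m))"
proof -
  define s where "s = sqrt (- a)"
  have s: "s > 1" "a = - (s^2)" using assms by (auto simp: s_def)
  define \<alpha> where "\<alpha> = inverse (2 * (s * (s + 1))) / s"
  define \<beta> where "\<beta> = inverse (2 * (s * (s - 1))) / s"
  have pos: "\<alpha> > 0" "\<beta> > 0" using s by (simp_all add: \<alpha>_def \<beta>_def)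
  have "- inverse (3 * s^2 + 2 * 1 * s + a) / s = - \<alpha>" "- inverse (3 * (- s)^2 + 2 * 1 * (- s) + a) / (- s) = \<beta>"
    by (simp_all add: s(2) \<alpha>_def \<beta>_def algebra_simps power2_eq_square)
  from this[THEN arg_cong[of _ _ complex_of_real]]
  have u: "- inverse (3 * (of_real s)^2 + 2 * of_real 1 * of_real s + of_real a) / complex_of_real s = of_real (- \<alpha>)"
    "- inverse (3 * (of_real (- s))^2 + 2 * of_real 1 * of_real (- s) + of_real a) / complex_of_real (- s) = of_real \<beta>"
    by simp_all
  show ?thesis
  proof (rule not_zeros_real_crossing[where b = a and c = 1 and ?x1.0 = "of_real (- s)" and ?x2.0 = "of_real s" and ?x3.0 = "of_real (- 1)"
        and ?z0.0 = a and \<rho> = s and ?W1.0 = 1 and ?W2.0 = \<i> and ?W3.0 = "- 1", unfolded u])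
    show "cubic_roots a 1 (of_real a) (of_real (- s)) (of_real s) (of_real (- 1))"
      using s unfolding cubic_roots_def s(2) by (auto simp: power2_eq_square power3_eq_cube complex_eq_iff)
    show "cmod (1 - of_real t) * cmod (- 1 - of_real t) \<le> (cmod (\<i> - of_real t))^2" for t
    proof -
      have "cmod (1 - of_real t) * cmod (- 1 - of_real t) = cmod (of_real (t^2 - 1))"
        unfolding norm_mult[symmetric] by (simp add: algebra_simps power2_eq_square)
      also have "\<dots> \<le> t^2 + 1" unfolding norm_of_real by (simp add: abs_if)
      also have "\<dots> = (cmod (\<i> - of_real t))^2" by (simp add: cmod_power2)
      finally show ?thesis .
    qed
  qed (use s pos in auto)
qed

text \<open>At z = a^3 the cubic is (x + a) (x^2 + (1 - a) x + a^2). For a > 1/3 the quadratic has a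
  non-real pair, and all three roots have modulus a.\<close>

lemma not_zeros_real_above:
  assumes "a > 1/3"
  shows "\<not> (\<forall>m. zeros_real (H a 1 m))"
proof -
  define y where "y = sqrt ((3 * a - 1) * (a + 1)) / 2"
  define x where "x = (a - 1) / 2"
  \<comment> \<open>K u equals 2a at the root -a and 2a - 1 - i h at X\<close>
  define h where "h = (3 * a - 1) / (2 * y)"
  define K where "K = 2 * a^3 * (3 * a - 1)"
  have y: "y > 0" "4 * y^2 = (3 * a - 1) * (a + 1)" using assms by (auto simp: y_def power_divide)
  have y2: "y^2 = (3 * a - 1) * (a + 1) / 4" using y(2) by simp
  have h: "h > 0" "2 * (h * y) = 3 * a - 1" using assms y(1) by (auto simp: h_def)
  have K: "K > 0" using assms by (simp add: K_def)
  define X where "X = Complex x y"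
  have mod: "cmod X = a" "cmod (cnj X) = a"
  proof -
    have "x^2 + y^2 = a^2" using y(2) by (simp add: x_def field_simps power2_eq_square)
    then show "cmod X = a" "cmod (cnj X) = a" using assms by (simp_all add: X_def complex_norm)
  qed
  have X2: "X^2 = Complex ((1 - 2 * a - a^2) / 2) (2 * x * y)"
    using y(2) by (simp add: X_def complex_eq_iff power2_eq_square x_def field_simps)
  have quad: "X^2 + of_real (1 - a) * X + of_real (a^2) = 0"
    unfolding X2 by (simp add: X_def complex_eq_iff x_def field_simps power2_eq_square)
  have cub: "X^3 + of_real 1 * X^2 + of_real a * X + of_real (a^3) = 0"
  proof -
    have "X^3 + of_real 1 * X^2 + of_real a * X + of_real (a^3) 
        = (X + of_real a) * (X^2 + of_real (1 - a) * X + of_real (a^2))"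
      by (simp add: algebra_simps power2_eq_square power3_eq_cube)
    then show ?thesis unfolding quad by simp
  qed
  then have "cnj (X^3 + of_real 1 * X^2 + of_real a * X + of_real (a^3)) = cnj 0" by (rule arg_cong)
  then have cub': "cnj X^3 + of_real 1 * cnj X^2 + of_real a * cnj X + of_real (a^3) = 0" by simp
  have roots: "cubic_roots a 1 (of_real (a^3)) (of_real (- a)) X (cnj X)"
  proof -
    have "of_real (- a) \<noteq> X" "of_real (- a) \<noteq> cnj X" "X \<noteq> cnj X" using y(1) by (auto simp: X_def complex_eq_iff)
    moreover have "(of_real (- a))^3 + of_real 1 * (of_real (- a))^2 + of_real a * of_real (- a) + of_real (a^3) = (0::complex)"
      by (simp add: power2_eq_square power3_eq_cube)
    ultimately show ?thesis unfolding cubic_roots_def using cub cub' by blast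
  qed
  define D where "D = 3 * X^2 + 2 * of_real 1 * X + of_real a"
  have XD: "X * D = Complex (- 2 * y^2 * (2 * a - 1)) (- y * (3 * a - 1))"
  proof -
    \<comment> \<open>Reduction modulo the cubic, so that only X^2 and X remain.\<close>
    have "X * D = 3 * (X^3 + of_real 1 * X^2 + of_real a * X + of_real (a^3)) - (X^2 + of_real (2 * a) * X + of_real (3 * a^3))"
      unfolding D_def by (simp add: algebra_simps power2_eq_square power3_eq_cube)
    also have "\<dots> = Complex (- 2 * y^2 * (2 * a - 1)) (- y * (3 * a - 1))"
      unfolding cub unfolding X2 y2
      by (simp add: X_def complex_eq_iff x_def field_simps power2_eq_square power3_eq_cube)
    finally show ?thesis .
  qed
  have "X * D * Complex (2 * a - 1) (- h) = of_real (- K)"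
  proof (rule complex_eqI)
    have "Re (X * D * Complex (2 * a - 1) (- h)) = - (4 * y^2) * (2 * a - 1)^2 / 2 - (3 * a - 1) * (2 * (h * y)) / 2"
      unfolding XD by (simp add: algebra_simps power2_eq_square add_divide_distrib diff_divide_distrib)
    also have "\<dots> = - K" unfolding y(2) h(2) K_def by (simp add: field_simps power2_eq_square power3_eq_cube)
    finally show "Re (X * D * Complex (2 * a - 1) (- h)) = Re (of_real (- K))" by simp
    have "Im (X * D * Complex (2 * a - 1) (- h)) = y * (2 * a - 1) * (2 * (h * y) - (3 * a - 1))"
      unfolding XD by (simp add: algebra_simps power2_eq_square)
    then show "Im (X * D * Complex (2 * a - 1) (- h)) = Im (of_real (- K))" unfolding h(2) by simp
  qed
  moreover have "X \<noteq> 0" "D \<noteq> 0"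
    using XD y(1) assms by (auto simp: complex_eq_iff)
  ultimately have uX: "- inverse D / X = Complex (2 * a - 1) (- h) / of_real K"
    using K by (simp add: field_simps)
  then have "cnj (- inverse D / X) = cnj (Complex (2 * a - 1) (- h) / of_real K)" by (rule arg_cong)
  then have uX': "- inverse (3 * cnj X^2 + 2 * of_real 1 * cnj X + of_real a) / cnj X = Complex (2 * a - 1) h / of_real K"
    unfolding D_def by (simp add: complex_eq_iff)
  have ua: "- inverse (3 * (of_real (- a))^2 + 2 * of_real 1 * of_real (- a) + of_real a) / complex_of_real (- a) = of_real (2 * a / K)"
  proof -
    have "- inverse (3 * (- a)^2 + 2 * 1 * (- a) + a) / (- a) = 2 * a / K"
      using assms by (simp add: K_def field_simps power2_eq_square power3_eq_cube)
    from arg_cong[OF this, of complex_of_real] show ?thesis by simp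
  qed
  \<comment> \<open>Up to the factor 1 / K, the derivatives along W1 are 2 a for -a and 2 a - 1 for
    the pair, so -a wins. Along W2 the roots -a and X tie at 2 a. Along W3 the root X wins with 2 a
    - 1 + sqrt 2, since sqrt 2 > 1. A larger factor than sqrt 2 would break the modulus condition,
    which is p (p + 2 q) \<le> (p + q)^2 with p = (1 - t)^2 and q = 1 / h^2.\<close>
  show ?thesis
  proof (rule not_zeros_real_crossing[where b = a and c = 1 and ?x1.0 = "of_real (- a)" and ?x2.0 = X and ?x3.0 = "cnj X"
        and ?z0.0 = "a^3" and \<rho> = a and ?W1.0 = 1 and ?W2.0 = "Complex 1 (1 / h)" and ?W3.0 = "Complex 1 (sqrt 2 / h)",
        unfolded ua uX' uX[unfolded D_def], OF roots])
    show "cmod (1 - of_real t) * cmod (Complex 1 (sqrt 2 / h) - of_real t) \<le> (cmod (Complex 1 (1 / h) - of_real t))^2" for t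
    proof -
      have "cmod (1 - of_real t) * cmod (Complex 1 (sqrt 2 / h) - of_real t) = sqrt ((1 - t)^2 * ((1 - t)^2 + 2 / h^2))"
        by (simp add: cmod_def real_sqrt_mult power_divide)
      also have "\<dots> \<le> (1 - t)^2 + 1 / h^2"
      proof (rule real_le_lsqrt)
        have "p * (p + 2 * q) \<le> (p + q)^2" for p q :: real by (simp add: power2_eq_square algebra_simps)
        from this[of "(1 - t)^2" "1 / h^2"]
        show "(1 - t)^2 * ((1 - t)^2 + 2 / h^2) \<le> ((1 - t)^2 + 1 / h^2)^2" by simp
      qed auto
      also have "\<dots> = (cmod (Complex 1 (1 / h) - of_real t))^2" by (simp add: cmod_power2 power_divide)
      finally show ?thesis .
    qed
  qed (use \<open>X \<noteq> 0\<close> assms K h(1) in \<open>simp_all add: mod field_simps add_pos_pos\<close>)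
qed

theorem theorem1p1:
  fixes b c :: real
  shows "((\<forall>m. zeros_real (H b c m)) \<longleftrightarrow>
           ((c = 0 \<and> b \<ge> 0) \<or> (c \<noteq> 0 \<and> -1 \<le> b / c^2 \<and> b / c^2 \<le> 1/3)))
       \<and> (c = 0 \<and> b > 0 \<longrightarrow> closure (zero_union b c) = UNIV)
       \<and> (c \<noteq> 0 \<and> -1 \<le> b / c^2 \<and> b / c^2 \<le> 1/3 \<longrightarrow>
            {c^3 * x | x. x \<le> (-2 + 9 * b / c^2 - 2 * sqrt ((1 - 3 * b / c^2)^3)) / 27}
              \<subseteq> closure (zero_union b c))"
proof (intro conjI impI)
  define a where "a = b / c^2"
  have ab: "9 * b / c^2 = 9 * a" "3 * b / c^2 = 3 * a" by (simp_all add: a_def)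
  show "(\<forall>m. zeros_real (H b c m)) \<longleftrightarrow>
      ((c = 0 \<and> b \<ge> 0) \<or> (c \<noteq> 0 \<and> -1 \<le> b / c^2 \<and> b / c^2 \<le> 1/3))"
  proof (cases "c = 0")
    case True
    consider "b < 0" | "b = 0" | "b > 0" by linarith
    then show ?thesis
    proof cases
      case 1
      \<comment> \<open>The first index with non-real zeros: for c = 0, H_3 = -z and H_5 = 2 b z
        have the zero 0 only, and the other earlier ones are constant.\<close>
      have H6: "H b c 6 = [:- of_real (b^3), 0, 1:]"
        using True by (simp add: eval_nat_numeral)
      define z where "z = \<i> * of_real (sqrt (- (b^3)))"
      have b3: "- (b^3) > 0" using 1 by (simp add: power_less_zero_eq)
      then have "z^2 = of_real (b^3)"
        unfolding z_def power_mult_distrib of_real_power[symmetric] by simp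
      then have "poly (H b c 6) z = 0" unfolding H6 by (simp add: power2_eq_square)
      moreover have "Im z \<noteq> 0" using b3 by (simp add: z_def)
      moreover have "H b c 6 \<noteq> 0" unfolding H6 by simp
      ultimately have "\<not> zeros_real (H b c 6)" unfolding zeros_real_def by blast
      then show ?thesis using True 1 by auto
    next
      case 2
      have "zeros_real (H 0 0 m)" for m by (auto simp: zeros_real_def H_b0)
      then show ?thesis using True 2 by simp
    next
      case 3
      then show ?thesis using True zeros_real_c0 by simp
    qed
  next
    case False
    then show ?thesis
      using zeros_real_scale[OF False, of b] not_zeros_real_below[of a] not_zeros_real_above[of a] zeros_real_c1[of a]
      unfolding a_def[symmetric] by (metis linorder_not_le)
  qed
  show "closure (zero_union b c) = UNIV" if "c = 0 \<and> b > 0"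
    using that zero_union_dense_c0 by simp
  show "{c^3 * x | x. x \<le> (-2 + 9 * b / c^2 - 2 * sqrt ((1 - 3 * b / c^2)^3)) / 27} \<subseteq> closure (zero_union b c)"
    if "c \<noteq> 0 \<and> -1 \<le> b / c^2 \<and> b / c^2 \<le> 1/3"
  proof -
    have "{..(-2 + 9 * a - 2 * sqrt ((1 - 3 * a)^3)) / 27} \<subseteq> closure (zero_union a 1)"
      using that by (intro zero_union_dense_c1) (auto simp: a_def)
    then show ?thesis using closure_zero_union_scale[of c _ b] that unfolding ab a_def[symmetric] by blast
  qed
qed

end
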